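(* Let $\Omega\subset\mathbb{R}^n$, $\Omega\neq\mathbb{R}^n$, be a domain (no smoothness of the boundary and no boundedness is assumed). For $p\in(1,\infty)$ let $H_p$ be the $L^p$ Hardy constant of $\Omega$. Then the function $$p\mapsto p\left(1+H_p^{1/p}\right)$$ is non-decreasing on $(1,+\infty)$.
   Context: A domain is a nonempty open connected set. $d(x)=\mathrm{dist}(x,\partial\Omega)$ for $x\in\Omega$. For $p\in(1,\infty)$, $W^{1,p}(\Omega)$ is the standard Sobolev space and $W^{1,p}_0(\Omega)$ is the closure of $C^\infty_c(\Omega)$ in $W^{1,p}(\Omega)$. The $L^p$ Hardy constant is $$H_p=\inf_{u\in W^{1,p}_0(\Omega),\,u\neq0}\frac{\int_\Omega|\nabla u|^p\,dx}{\int_\Omega \frac{|u|^p}{d^p}\,dx}\ \ge 0,$$ where the quotient is read as $0$ if the denominator is infinite; equivalently, $H_p$ is the largest $c\ge0$ such that $\int_\Omega|\nabla u|^p\,dx\ge c\int_\Omega |u|^p/d^p\,dx$ for all $u\in C^\infty_c(\Omega)$. *)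

theory Defs
  imports "HOL-Analysis.Analysis"
begin

definition partial_deriv :: "'a::euclidean_space \<Rightarrow> ('a \<Rightarrow> real) \<Rightarrow> 'a \<Rightarrow> real" where
  "partial_deriv i f x = frechet_derivative f (at x) i"

definition gradient :: "('a::euclidean_space \<Rightarrow> real) \<Rightarrow> 'a \<Rightarrow> 'a" where
  "gradient f x = (\<Sum>i\<in>Basis. partial_deriv i f x *\<^sub>R i)"

fun C_k :: "nat \<Rightarrow> ('a::euclidean_space \<Rightarrow> real) \<Rightarrow> bool" where
  "C_k 0 f \<longleftrightarrow> continuous_on UNIV f"
| "C_k (Suc k) f \<longleftrightarrow> (\<forall>x. f differentiable (at x)) \<and> (\<forall>i\<in>Basis. C_k k (partial_deriv i f))"

(* C_c^infinity(\<Omega>); its elements are taken to be extended by 0 to the whole space. *)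
definition test_functions :: "'a::euclidean_space set \<Rightarrow> ('a \<Rightarrow> real) set" where
  "test_functions \<Omega> =
    {\<phi>. (\<forall>k. C_k k \<phi>) \<and> compact (closure {x. \<phi> x \<noteq> 0}) \<and> closure {x. \<phi> x \<noteq> 0} \<subseteq> \<Omega>}"

definition in_Lp :: "'a::euclidean_space set \<Rightarrow> real \<Rightarrow> ('a \<Rightarrow> 'b::euclidean_space) \<Rightarrow> bool" where
  "in_Lp \<Omega> p f \<longleftrightarrow> f \<in> borel_measurable (lebesgue_on \<Omega>) \<and>
     integrable (lebesgue_on \<Omega>) (\<lambda>x. norm (f x) powr p)"

definition locally_integrable ::
  "'a::euclidean_space set \<Rightarrow> ('a \<Rightarrow> 'b::euclidean_space) \<Rightarrow> bool" where
  "locally_integrable \<Omega> f \<longleftrightarrow> (\<forall>K. compact K \<and> K \<subseteq> \<Omega> \<longrightarrow> integrable (lebesgue_on K) f)"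

definition has_weak_gradient ::
  "'a::euclidean_space set \<Rightarrow> ('a \<Rightarrow> real) \<Rightarrow> ('a \<Rightarrow> 'a) \<Rightarrow> bool" where
  "has_weak_gradient \<Omega> u g \<longleftrightarrow> locally_integrable \<Omega> u \<and> locally_integrable \<Omega> g \<and>
     (\<forall>\<phi>\<in>test_functions \<Omega>. \<forall>i\<in>Basis.
        (LINT x|lebesgue_on \<Omega>. u x * partial_deriv i \<phi> x) =
        - (LINT x|lebesgue_on \<Omega>. (g x \<bullet> i) * \<phi> x))"

(* Classes modulo null sets are replaced by representatives, and since a weak gradient is
   determined only almost everywhere, W^{1,p}(\<Omega>) is given as the set of pairs (u, g) in which
   g is a (representative of the) weak gradient of u. Only the values on \<Omega> matter. *)
definition sobolev :: "'a::euclidean_space set \<Rightarrow> real \<Rightarrow> (('a \<Rightarrow> real) \<times> ('a \<Rightarrow> 'a)) set" where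
  "sobolev \<Omega> p = {(u, g). has_weak_gradient \<Omega> u g \<and> in_Lp \<Omega> p u \<and> in_Lp \<Omega> p g}"

definition sobolev_norm ::
  "'a::euclidean_space set \<Rightarrow> real \<Rightarrow> ('a \<Rightarrow> real) \<Rightarrow> ('a \<Rightarrow> 'a) \<Rightarrow> real" where
  "sobolev_norm \<Omega> p u g =
    ((LINT x|lebesgue_on \<Omega>. \<bar>u x\<bar> powr p) + (LINT x|lebesgue_on \<Omega>. norm (g x) powr p)) powr (1 / p)"

(* W^{1,p}_0(\<Omega>), the closure of the test functions in W^{1,p}(\<Omega>). *)
definition sobolev0 :: "'a::euclidean_space set \<Rightarrow> real \<Rightarrow> (('a \<Rightarrow> real) \<times> ('a \<Rightarrow> 'a)) set" where
  "sobolev0 \<Omega> p = {(u, g) \<in> sobolev \<Omega> p. \<forall>e>0. \<exists>\<phi>\<in>test_functions \<Omega>.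
      sobolev_norm \<Omega> p (\<lambda>x. u x - \<phi> x) (\<lambda>x. g x - gradient \<phi> x) < e}"

definition bdist :: "'a::euclidean_space set \<Rightarrow> 'a \<Rightarrow> real" where
  "bdist \<Omega> x = infdist x (frontier \<Omega>)"

(* The integrability test tells whether the integral of |u|^p / d^p is finite. *)
definition hardy_quotient ::
  "'a::euclidean_space set \<Rightarrow> real \<Rightarrow> ('a \<Rightarrow> real) \<Rightarrow> ('a \<Rightarrow> 'a) \<Rightarrow> real" where
  "hardy_quotient \<Omega> p u g =
    (if integrable (lebesgue_on \<Omega>) (\<lambda>x. \<bar>u x\<bar> powr p / bdist \<Omega> x powr p)
     then (LINT x|lebesgue_on \<Omega>. norm (g x) powr p) /
          (LINT x|lebesgue_on \<Omega>. \<bar>u x\<bar> powr p / bdist \<Omega> x powr p)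
     else 0)"

(* u \<noteq> 0 is meant in L^p(\<Omega>), i.e. u does not vanish almost everywhere. *)
definition hardy_constant :: "'a::euclidean_space set \<Rightarrow> real \<Rightarrow> real" where
  "hardy_constant \<Omega> p =
    Inf {hardy_quotient \<Omega> p u g | u g.
          (u, g) \<in> sobolev0 \<Omega> p \<and> \<not> (AE x in lebesgue_on \<Omega>. u x = 0)}"

end

theory Submission
  imports Defs
begin

text \<open>
  Let \<open>p < q\<close>, \<open>a = q / p\<close> and let \<open>d\<close> be the distance to the boundary. For a test function \<open>\<phi>\<close> the
  function \<open>v = \<bar>\<phi>\<bar>\<^sup>a d\<^sup>1\<^sup>-\<^sup>a\<close> satisfies \<open>(v / d)\<^sup>p = (\<bar>\<phi>\<bar> / d)\<^sup>q\<close>, and since \<open>d\<close> is 1-Lipschitz, its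
  gradient is bounded by \<open>a X\<^sup>a\<^sup>-\<^sup>1 Y + (a - 1) X\<^sup>a\<close>, where \<open>X = \<bar>\<phi>\<bar> / d\<close> and \<open>Y = \<bar>\<nabla>\<phi>\<bar>\<close>.
  The \<open>L\<^sup>p\<close> Hardy inequality for \<open>v\<close>, together with convexity and Young's inequality, gives the \<open>L\<^sup>q\<close>
  Hardy inequality for \<open>\<phi>\<close> with a constant \<open>\<theta>\<^sup>q\<close> such that \<open>q (1 + \<theta>) = p (1 + H\<^sub>p\<^sup>1\<^sup>/\<^sup>p)\<close>.
  Fatou's lemma extends it to the closure of the test functions.
\<close>

subsection \<open>Functions of class $C^k$\<close>

text \<open>The value of \<theta> is the one that Minkowski's and Hoelder's inequalities predict.
  Writing \<open>h\<close> for the \<open>p\<close>-th root of H_p and |.|_q for the L^q norm, they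
  would give h |X|_q^a \<le> a |X|_q^(a-1) |Y|_q + (a - 1) |X|_q^a, that is |Y|_q \<ge> \<theta>
  |X|_q with \<theta> = (h + 1) / a - 1. The pointwise inequality used instead is tuned to become an
  equality at Y = \<theta> X, so no constant is lost. If \<theta> \<le> 0 there is nothing to prove,
  because the root of H_q is nonnegative. The obstacle is that \<open>v\<close> is not a test
  function: the distance is merely Lipschitz, and the power a > 1 of an absolute value need not be
  smooth at zeros. Instead of a gradient almost everywhere, \<open>v\<close> is given a local
  Lipschitz bound at every point. Such bounds obey the product and chain rules and control the
  gradients of mollifications, which are test functions.\<close>

lemma partial_deriv_eqI:
  assumes "(f has_derivative f') (at x)"
  shows "partial_deriv i f x = f' i"
  unfolding partial_deriv_def using frechet_derivative_at[OF assms] by simp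

lemma gradient_has_derivative:
  fixes f :: "'a::euclidean_space \<Rightarrow> real"
  assumes "f differentiable (at x)"
  shows "(f has_derivative (\<lambda>h. gradient f x \<bullet> h)) (at x)"
proof -
  let ?D = "frechet_derivative f (at x)"
  have D: "(f has_derivative ?D) (at x)"
    using assms frechet_derivative_works by blast
  then have lin: "linear ?D"
    by (rule has_derivative_linear)
  have "?D h = gradient f x \<bullet> h" for h
  proof -
    have "?D h = ?D (\<Sum>i\<in>Basis. (h \<bullet> i) *\<^sub>R i)"
      by (simp add: euclidean_representation)
    also have "\<dots> = (\<Sum>i\<in>Basis. (h \<bullet> i) * ?D i)"
      by (simp add: linear_sum[OF lin] linear_scale[OF lin])
    also have "\<dots> = gradient f x \<bullet> h"
      by (simp add: gradient_def partial_deriv_def inner_sum_left inner_commute[of h] mult.commute)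
    finally show ?thesis .
  qed
  then show ?thesis by (intro has_derivative_eq_rhs[OF D] ext)
qed

lemma gradient_inner_Basis:
  "i \<in> Basis \<Longrightarrow> gradient f x \<bullet> i = partial_deriv i f x"
  by (simp add: gradient_def inner_sum_left inner_Basis if_distrib sum.delta cong: if_cong)

lemma C_k_Suc_imp: "C_k (Suc k) f \<Longrightarrow> C_k k f"
proof (induction k arbitrary: f)
  case 0
  then show ?case
    by (auto intro!: differentiable_imp_continuous_on simp: differentiable_on_def differentiable_at_withinI)
next
  case (Suc k)
  then show ?case by (simp del: C_k.simps add: C_k.simps(2)[of "Suc k"]) (simp add: Suc.IH)
qed

lemma C_k_imp_continuous: "C_k k f \<Longrightarrow> continuous_on UNIV f"
  by (induction k) (simp, metis C_k_Suc_imp)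

lemma C_k_const: "C_k k (\<lambda>x::'a::euclidean_space. c::real)"
proof (induction k arbitrary: c)
  case (Suc k)
  have "partial_deriv i (\<lambda>x::'a. c) = (\<lambda>x. 0)" for i
    by (rule ext, rule partial_deriv_eqI[where f'="\<lambda>_. 0"]) auto
  with Suc show ?case by simp
qed simp

lemma C_k_inner: "C_k k (\<lambda>x::'a::euclidean_space. (x - z) \<bullet> j)"
proof (cases k)
  case 0
  then show ?thesis by (auto intro!: continuous_intros)
next
  case (Suc k)
  have D: "((\<lambda>x. (x - z) \<bullet> j) has_derivative (\<lambda>h. h \<bullet> j)) (at x)" for x
    by (auto intro!: derivative_eq_intros)
  then have "partial_deriv i (\<lambda>x::'a. (x - z) \<bullet> j) = (\<lambda>x. i \<bullet> j)" for i
    by (intro ext partial_deriv_eqI) 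
  with D Suc show ?thesis by (auto simp: C_k_const intro: differentiableI)
qed

lemma C_k_add:
  assumes "C_k k f" "C_k k g"
  shows "C_k k (\<lambda>x. f x + g x)"
  using assms
proof (induction k arbitrary: f g)
  case 0
  then show ?case by (auto intro: continuous_intros)
next
  case (Suc k)
  then have d: "f differentiable (at x)" "g differentiable (at x)" for x by auto
  have "partial_deriv i (\<lambda>x. f x + g x) = (\<lambda>x. partial_deriv i f x + partial_deriv i g x)" for i
  proof
    fix x
    show "partial_deriv i (\<lambda>x. f x + g x) x = partial_deriv i f x + partial_deriv i g x"
      unfolding partial_deriv_def
      by (rule partial_deriv_eqI[unfolded partial_deriv_def])
         (intro has_derivative_add d[unfolded frechet_derivative_works])
  qed
  with Suc d show ?case by (auto intro: differentiable_add)
qed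

lemma partial_deriv_mult:
  assumes "f differentiable (at x)" "g differentiable (at x)"
  shows "partial_deriv i (\<lambda>x. f x * g x) x = f x * partial_deriv i g x + partial_deriv i f x * g x"
  unfolding partial_deriv_def
  by (rule partial_deriv_eqI[unfolded partial_deriv_def])
     (intro has_derivative_mult assms[unfolded frechet_derivative_works])

lemma C_k_mult:
  assumes "C_k k f" "C_k k g"
  shows "C_k k (\<lambda>x. f x * g x)"
  using assms
proof (induction k arbitrary: f g)
  case 0
  then show ?case by (auto intro: continuous_intros)
next
  case (Suc k)
  then have d: "f differentiable (at x)" "g differentiable (at x)" for x by auto
  have "partial_deriv i (\<lambda>x. f x * g x) =
      (\<lambda>x. f x * partial_deriv i g x + partial_deriv i f x * g x)" for i
    using d by (intro ext partial_deriv_mult)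
  moreover have "C_k k f" "C_k k g" using Suc.prems C_k_Suc_imp by blast+
  ultimately show ?case using Suc d by (auto intro!: differentiable_mult C_k_add)
qed

subsection \<open>A smooth bump\<close>

text \<open>The factor \<open>1 / t ^ n\<close> makes the family closed under differentiation: the
  derivative of one member is a combination of the members of index \<open>n + 1\<close> and
  \<open>n + 2\<close>. Smoothness then follows by a single induction for all
  \<open>n\<close>.\<close>

definition flat_exp :: "nat \<Rightarrow> real \<Rightarrow> real" where
  "flat_exp n t = (if t > 0 then exp (- 1 / t) / t ^ n else 0)"

text \<open>With \<open>x = 1 / t\<close>, the single term of degree \<open>n + 1\<close> of the
  exponential series is at most \<open>exp x\<close>. Taking degree \<open>n + 1\<close> rather than
  \<open>n\<close> gains the factor \<open>t\<close>, hence the limit 0 at the origin.\<close>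

lemma flat_exp_bound: "\<bar>flat_exp n t\<bar> \<le> fact (Suc n) * \<bar>t\<bar>"
proof (cases "t > 0")
  case True
  define x where "x = 1 / t"
  have x: "x > 0" using True by (simp add: x_def)
  obtain s where s: "exp x = (\<Sum>m<Suc (Suc n). x ^ m / fact m) + exp s / fact (Suc (Suc n)) * x ^ Suc (Suc n)"
    using Maclaurin_exp_le by blast
  have "x ^ Suc n / fact (Suc n) \<le> (\<Sum>m<Suc (Suc n). x ^ m / fact m)"
    using x by (intro member_le_sum) auto
  also have "\<dots> \<le> exp x" unfolding s using x by simp
  finally have "x ^ Suc n * exp (- x) \<le> fact (Suc n)"
    by (simp add: exp_minus divide_simps mult.commute del: fact_Suc power_Suc)
  then have "x ^ n * exp (- x) \<le> fact (Suc n) * t"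
    using True by (simp add: x_def field_simps)
  with True show ?thesis by (simp add: flat_exp_def x_def field_simps abs_mult)
qed (simp add: flat_exp_def mult_nonneg_nonpos del: fact_Suc)

text \<open>The delicate point is \<open>t = 0\<close>: there the difference quotient of the member
  of index \<open>n\<close> is exactly the member of index \<open>n + 1\<close>, which tends to 0 by
  the linear bound.\<close>

lemma flat_exp_deriv:
  "(flat_exp n has_real_derivative (flat_exp (n + 2) t - n * flat_exp (n + 1) t)) (at t)"
proof -
  consider "t > 0" | "t < 0" | "t = 0" by linarith
  then show ?thesis
  proof cases
    case 1
    have "((\<lambda>t. exp (- 1 / t) / t ^ n) has_real_derivative
        (exp (- 1 / t) / t ^ (n + 2) - n * (exp (- 1 / t) / t ^ (n + 1)))) (at t)"
    proof -
      have e: "((\<lambda>t. exp (- 1 / t)) has_real_derivative exp (- 1 / t) / t\<^sup>2) (at t)"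
        using 1 by (auto intro!: derivative_eq_intros simp: power2_eq_square)
      have n: "real n * t ^ (n - Suc 0) = real n * t ^ n / t"
        using 1 by (cases n) auto
      show ?thesis
        using 1 by (rule_tac DERIV_cong[OF DERIV_divide[OF e DERIV_pow]])
          (auto simp: n, simp add: field_simps power2_eq_square)
    qed
    then have "((\<lambda>t. exp (- 1 / t) / t ^ n) has_real_derivative
        (flat_exp (n + 2) t - n * flat_exp (n + 1) t)) (at t)"
      using 1 by (simp add: flat_exp_def)
    then show ?thesis
      by (rule has_field_derivative_transform_within_open[where S="{0<..}"])
         (use 1 in \<open>auto simp: flat_exp_def\<close>)
  next
    case 2
    have "((\<lambda>t. 0) has_real_derivative (flat_exp (n + 2) t - n * flat_exp (n + 1) t)) (at t)"
      using 2 by (simp add: flat_exp_def)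
    then show ?thesis
      by (rule has_field_derivative_transform_within_open[where S="{..<0}"])
         (use 2 in \<open>auto simp: flat_exp_def\<close>)
  next
    case 3
    have "((\<lambda>h. fact (Suc (Suc n)) * \<bar>h\<bar>) \<longlongrightarrow> (0::real)) (at 0)"
      by (auto intro!: tendsto_eq_intros)
    then have "(flat_exp (Suc n) \<longlongrightarrow> 0) (at 0)"
      by (rule Lim_null_comparison[rotated]) (simp add: flat_exp_bound del: fact_Suc)
    moreover have "(flat_exp n (0 + h) - flat_exp n 0) / h = flat_exp (Suc n) h" for h
      by (simp add: flat_exp_def)
    ultimately show ?thesis using 3 by (simp add: DERIV_def flat_exp_def[of _ 0])
  qed
qed

text \<open>This is the classical bump exp(-1 / (r^2 - |x - z|^2)) on the ball of radius
  \<open>r\<close>, extended by 0. The squared distance is a polynomial in the coordinates, hence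
  smooth at the centre too.\<close>

definition bump :: "'a::euclidean_space \<Rightarrow> real \<Rightarrow> 'a \<Rightarrow> real" where
  "bump z r x = flat_exp 0 (r\<^sup>2 - (x - z) \<bullet> (x - z))"

text \<open>Here \<open>r\<close> plays the role of the squared radius. The index \<open>n\<close>
  is kept arbitrary because each differentiation raises it, besides producing a factor linear in
  \<open>x\<close>.\<close>

lemma C_k_flat_exp: "C_k k (\<lambda>x::'a::euclidean_space. flat_exp n (r - (x - z) \<bullet> (x - z)))"
proof (induction k arbitrary: n)
  case (Suc k)
  let ?q = "\<lambda>x::'a. r - (x - z) \<bullet> (x - z)"
  have D: "((\<lambda>x. flat_exp n (?q x)) has_derivative
      (\<lambda>h. (flat_exp (n + 2) (?q x) - n * flat_exp (n + 1) (?q x)) * (- 2 * ((x - z) \<bullet> h)))) (at x)" for x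
  proof -
    have q: "(?q has_derivative (\<lambda>h. - 2 * ((x - z) \<bullet> h))) (at x)"
      by (auto intro!: derivative_eq_intros simp: inner_commute)
    have f: "(flat_exp n has_derivative
        (\<lambda>h. (flat_exp (n + 2) (?q x) - n * flat_exp (n + 1) (?q x)) * h)) (at (?q x))"
      using flat_exp_deriv by (simp add: has_field_derivative_def)
    show ?thesis using has_derivative_compose[OF q f] .
  qed
  have P: "partial_deriv i (\<lambda>x. flat_exp n (?q x)) =
      (\<lambda>x. (flat_exp (n + 2) (?q x) + (- real n) * flat_exp (n + 1) (?q x)) * (- 2 * ((x - z) \<bullet> i)))" for i
    by (rule ext) (subst partial_deriv_eqI[OF D], simp)
  show ?case unfolding C_k.simps P
    using D by (intro conjI allI ballI C_k_mult C_k_add C_k_const C_k_inner Suc)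
      (auto intro: differentiableI)
next
  case 0
  have "continuous_on UNIV (flat_exp n)"
    using flat_exp_deriv by (intro DERIV_continuous_on) (auto intro: DERIV_subset)
  then show ?case
    by (auto intro!: continuous_on_compose2[of UNIV "flat_exp n"] continuous_intros)
qed

lemma C_k_bump: "C_k k (bump z r)"
  using C_k_flat_exp[of k 0 "r\<^sup>2" z] by (simp add: bump_def[abs_def])

lemma bump_nonneg: "0 \<le> bump z r x"
  by (simp add: bump_def flat_exp_def)

lemma bump_pos_iff: "r > 0 \<Longrightarrow> 0 < bump z r x \<longleftrightarrow> dist x z < r"
proof -
  assume r: "r > 0"
  have "(x - z) \<bullet> (x - z) < r\<^sup>2 \<longleftrightarrow> dist x z < r"
    using r by (simp add: dist_norm power2_norm_eq_inner[symmetric] norm_lt_square)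
  then show ?thesis by (auto simp: bump_def flat_exp_def)
qed

subsection \<open>Compactly supported functions\<close>

text \<open>Continuity is required on \<open>K\<close> only, so \<open>f\<close> may jump at the
  boundary of \<open>K\<close>, as the dominating functions of
  \<open>integrable_const_compact\<close> do.\<close>

lemma integrable_compact_support:
  fixes f :: "'a::euclidean_space \<Rightarrow> 'b::euclidean_space"
  assumes "compact K" "continuous_on K f" "\<And>x. x \<notin> K \<Longrightarrow> f x = 0"
  shows "integrable lborel f"
proof -
  have "f = (\<lambda>x. indicator K x *\<^sub>R f x)"
    using assms(3) by (auto simp: indicator_def)
  then show ?thesis
    using borel_integrable_compact[OF assms(1,2)] by simp
qed

lemma integrable_const_compact:
  fixes K :: "'a::euclidean_space set"
  assumes "compact K"
  shows "integrable lborel (\<lambda>x. if x \<in> K then c else 0 :: real)"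
proof (rule integrable_compact_support[OF assms])
  show "continuous_on K (\<lambda>x. if x \<in> K then c else 0)"
    by (subst continuous_on_cong[where g="\<lambda>_. c"]) auto
qed auto

text \<open>Links the integrals over \<open>\<Omega>\<close> in the definitions to integrals over
  the whole space, where translation and reflection are available.\<close>

lemma integrable_lebesgue_on_support:
  fixes f :: "'a::euclidean_space \<Rightarrow> 'b::euclidean_space"
  assumes "\<Omega> \<in> sets lebesgue" "integrable lborel f" "\<And>x. x \<notin> \<Omega> \<Longrightarrow> f x = 0"
  shows "integrable (lebesgue_on \<Omega>) f"
    and "integral\<^sup>L (lebesgue_on \<Omega>) f = integral\<^sup>L lborel f"
proof -
  have f: "(\<lambda>x. indicator \<Omega> x *\<^sub>R f x) = f"
    using assms(3) by (auto simp: indicator_def)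
  have m: "f \<in> borel_measurable lborel" using assms(2) by simp
  show "integrable (lebesgue_on \<Omega>) f"
    using assms(1,2) integrable_completion[OF m] by (simp add: integrable_restrict_space f)
  show "integral\<^sup>L (lebesgue_on \<Omega>) f = integral\<^sup>L lborel f"
    using assms(1) integral_completion[OF m] by (simp add: integral_restrict_space f)
qed

section \<open>Translation, reflection, and derivatives of compactly supported functions\<close>

lemma lborel_integral_translation:
  fixes f :: "'a::euclidean_space \<Rightarrow> real"
  assumes "f \<in> borel_measurable borel"
  shows "(\<integral>x. f (x + c) \<partial>lborel) = (\<integral>x. f x \<partial>lborel)"
    and "integrable lborel (\<lambda>x. f (x + c)) \<longleftrightarrow> integrable lborel f"
proof -
  have "distr lborel borel (\<lambda>x. x + c) = lborel"
    using lborel_distr_plus[of c] by (simp add: add.commute[of _ c])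
  then show "(\<integral>x. f (x + c) \<partial>lborel) = (\<integral>x. f x \<partial>lborel)"
    "integrable lborel (\<lambda>x. f (x + c)) \<longleftrightarrow> integrable lborel f"
    using integral_distr[of "\<lambda>x. x + c" lborel borel f]
      integrable_distr_eq[of "\<lambda>x. x + c" lborel borel f] assms by simp_all
qed

lemma lborel_integral_reflection:
  fixes f :: "'a::euclidean_space \<Rightarrow> real"
  assumes "f \<in> borel_measurable borel"
  shows "(\<integral>x. f (c - x) \<partial>lborel) = (\<integral>x. f x \<partial>lborel)"
    and "integrable lborel (\<lambda>x. f (c - x)) \<longleftrightarrow> integrable lborel f"
proof -
  have "distr lborel borel (\<lambda>x. c - x) = lborel"
    by (subst (2) lborel_affine[of "-1" c]) (simp_all add: density_1)
  then show "(\<integral>x. f (c - x) \<partial>lborel) = (\<integral>x. f x \<partial>lborel)"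
    "integrable lborel (\<lambda>x. f (c - x)) \<longleftrightarrow> integrable lborel f"
    using integral_distr[of "\<lambda>x. c - x" lborel borel f]
      integrable_distr_eq[of "\<lambda>x. c - x" lborel borel f] assms by simp_all
qed

lemma partial_deriv_eq_0_outside:
  assumes "closed K" "\<And>x. x \<notin> K \<Longrightarrow> f x = 0" "x \<notin> K"
  shows "partial_deriv i f x = 0"
proof -
  have "(f has_derivative (\<lambda>_. 0)) (at x)"
    by (rule has_derivative_transform_within_open[OF has_derivative_const, of "- K"])
       (use assms in auto)
  then show ?thesis by (rule partial_deriv_eqI)
qed

lemma gradient_eq_0_outside:
  assumes "closed K" "\<And>x. x \<notin> K \<Longrightarrow> f x = 0" "x \<notin> K"
  shows "gradient f x = 0"
  using partial_deriv_eq_0_outside[OF assms] by (simp add: gradient_def)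

lemma continuous_gradient:
  "C_k (Suc k) f \<Longrightarrow> continuous_on UNIV (gradient f)"
  unfolding gradient_def[abs_def]
  by (auto intro!: continuous_intros intro: C_k_imp_continuous)

lemma bounded_compact_support:
  fixes f :: "'a::topological_space \<Rightarrow> 'b::real_normed_vector"
  assumes "compact K" "continuous_on K f" "\<And>x. x \<notin> K \<Longrightarrow> f x = 0"
  obtains B where "B > 0" "\<And>x. norm (f x) \<le> B"
proof -
  have "bounded (f ` K)"
    using assms compact_continuous_image compact_imp_bounded by blast
  then obtain B where B: "B > 0" "\<And>x. x \<in> K \<Longrightarrow> norm (f x) \<le> B"
    unfolding bounded_pos by auto
  then show ?thesis using that[of B] assms(3) by (metis less_eq_real_def norm_zero)
qed

lemma C1_compact_support_Lipschitz:
  assumes f: "C_k 1 f" and K: "compact K" "\<And>x. x \<notin> K \<Longrightarrow> f x = 0"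
  obtains L where "L > 0" "\<And>x y. \<bar>f x - f y\<bar> \<le> L * dist x y"
proof -
  have c: "continuous_on UNIV (gradient f)"
    using f continuous_gradient[of 0 f] by simp
  obtain L where L: "L > 0" "\<And>x. norm (gradient f x) \<le> L"
    by (rule bounded_compact_support[of K "gradient f"])
       (use K c gradient_eq_0_outside[OF compact_imp_closed[OF K(1)] K(2)]
        in \<open>auto intro: continuous_on_subset\<close>)
  have d: "(f has_derivative (\<lambda>h. gradient f x \<bullet> h)) (at x)" for x
    by (intro gradient_has_derivative) (use f in simp)
  have o: "onorm (\<lambda>h. gradient f x \<bullet> h) \<le> L" for x
    by (rule onorm_bound)
       (use L(1) L(2)[of x] in \<open>auto intro!: order_trans[OF Cauchy_Schwarz_ineq2] mult_right_mono\<close>)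
  have "norm (f x - f y) \<le> L * norm (x - y)" for x y
    by (rule differentiable_bound[of UNIV]) (use d o in auto)
  then show ?thesis using that L(1) by (simp add: dist_norm)
qed

text \<open>By translation invariance every difference quotient in direction \<open>i\<close> has
  integral 0. The quotients are bounded by a Lipschitz constant on a fixed compact set, so dominated
  convergence carries this over to the derivative; no iterated integrals are involved.\<close>

lemma integral_partial_deriv_eq_0:
  fixes f :: "'a::euclidean_space \<Rightarrow> real"
  assumes f: "C_k 1 f" and K: "compact K" "\<And>x. x \<notin> K \<Longrightarrow> f x = 0"
  shows "(\<integral>x. partial_deriv i f x \<partial>lborel) = 0"
proof -
  obtain L where L: "L > 0" "\<And>x y. \<bar>f x - f y\<bar> \<le> L * dist x y"
    using C1_compact_support_Lipschitz[OF f K] by metis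
  define t where "t n = 1 / real (Suc n)" for n
  have t: "t n > 0" "t n \<le> 1" for n by (auto simp: t_def)
  have tlim: "t \<longlonglongrightarrow> 0" unfolding t_def using LIMSEQ_inverse_real_of_nat
    by (simp add: inverse_eq_divide)
  define s where "s n x = (f (x + t n *\<^sub>R i) - f x) / t n" for n x
  \<comment> \<open>The steps \<open>t n\<close> are at most 1, so this one compact set contains the
    supports of all difference quotients.\<close>
  define K1 where "K1 = {x + y |x y. x \<in> K \<and> y \<in> cball 0 (norm i)}"
  have K1: "compact K1" unfolding K1_def using K(1) by (intro compact_sums) auto
  have in_K1: "x \<in> K1" if "x \<in> K \<or> x + t n *\<^sub>R i \<in> K" for x n
  proof -
    have "x \<in> K \<Longrightarrow> x \<in> K1" unfolding K1_def
      by (rule CollectI, rule exI[of _ x], rule exI[of _ 0]) auto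
    moreover have "x + t n *\<^sub>R i \<in> K \<Longrightarrow> x \<in> K1" unfolding K1_def
      using t[of n]
      by (intro CollectI exI[of _ "x + t n *\<^sub>R i"] exI[of _ "- (t n *\<^sub>R i)"])
         (auto intro: mult_left_le_one_le)
    ultimately show ?thesis using that by blast
  qed
  have cf: "continuous_on UNIV f" using f C_k_imp_continuous by blast
  have mf: "f \<in> borel_measurable borel" by (rule borel_measurable_continuous_onI[OF cf])
  have if0: "integrable lborel f"
    by (rule integrable_compact_support[OF K(1) _ K(2)]) (auto intro: continuous_on_subset[OF cf])
  have int0: "(\<integral>x. s n x \<partial>lborel) = 0" for n
    unfolding s_def using lborel_integral_translation[OF mf] if0 by simp
  have "(\<lambda>n. \<integral>x. s n x \<partial>lborel) \<longlonglongrightarrow> (\<integral>x. partial_deriv i f x \<partial>lborel)"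
  proof (rule integral_dominated_convergence)
    show "integrable lborel (\<lambda>x. if x \<in> K1 then L * norm i else 0)"
      by (rule integrable_const_compact[OF K1])
    show "s n \<in> borel_measurable lborel" for n
      unfolding s_def[abs_def] using mf by measurable
    have lim: "(\<lambda>n. s n x) \<longlonglongrightarrow> partial_deriv i f x" for x
    proof -
      have D: "(f has_derivative frechet_derivative f (at x)) (at x)"
        using f by (simp add: frechet_derivative_works)
      have "((\<lambda>h. f (x + h *\<^sub>R i)) has_derivative (\<lambda>h. frechet_derivative f (at x) (h *\<^sub>R i))) (at 0)"
      proof (rule has_derivative_compose[where g=f])
        show "((\<lambda>h. x + h *\<^sub>R i) has_derivative (\<lambda>h. h *\<^sub>R i)) (at 0)"
          by (auto intro!: derivative_eq_intros)
      qed (use D in simp)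
      then have "((\<lambda>h. f (x + h *\<^sub>R i)) has_derivative (\<lambda>h. partial_deriv i f x * h)) (at 0)"
        using linear_scale[OF has_derivative_linear[OF D]]
        by (simp add: partial_deriv_def mult.commute)
      then have "((\<lambda>h. (f (x + h *\<^sub>R i) - f x) / h) \<longlongrightarrow> partial_deriv i f x) (at 0)"
        by (simp add: has_field_derivative_def[symmetric] DERIV_def)
      then show ?thesis unfolding s_def
        by (rule filterlim_compose) (use tlim t in \<open>auto simp: filterlim_at less_imp_neq[symmetric]\<close>)
    qed
    then show "AE x in lborel. (\<lambda>n. s n x) \<longlonglongrightarrow> partial_deriv i f x" by simp
    show "(\<lambda>x. partial_deriv i f x) \<in> borel_measurable lborel"
      by (rule borel_measurable_LIMSEQ_real[OF lim]) (use mf in \<open>simp add: s_def[abs_def]\<close>)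
    have "norm (s n x) \<le> (if x \<in> K1 then L * norm i else 0)" for n x
    proof (cases "x \<in> K1")
      case True
      have "\<bar>f (x + t n *\<^sub>R i) - f x\<bar> \<le> L * (t n * norm i)"
        using L(2)[of "x + t n *\<^sub>R i" x] t[of n] by (simp add: dist_norm)
      then show ?thesis using True t[of n] by (simp add: s_def field_simps)
    next
      case False
      then show ?thesis using in_K1 K(2) by (metis s_def diff_self div_0 norm_zero order_refl)
    qed
    then show "AE x in lborel. norm (s n x) \<le> (if x \<in> K1 then L * norm i else 0)" for n by simp
  qed
  then show ?thesis by (simp add: int0 LIMSEQ_const_iff)
qed

subsection \<open>Test functions\<close>

lemma test_functionsI:
  assumes "\<And>k. C_k k \<phi>" "compact K" "K \<subseteq> \<Omega>" "\<And>x. x \<notin> K \<Longrightarrow> \<phi> x = 0"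
  shows "\<phi> \<in> test_functions \<Omega>"
proof -
  have s: "closure {x. \<phi> x \<noteq> 0} \<subseteq> K"
    using assms by (intro closure_minimal) (auto simp: compact_imp_closed)
  then have "compact (closure {x. \<phi> x \<noteq> 0})"
    using compact_Int_closed[OF assms(2) closed_closure, of "{x. \<phi> x \<noteq> 0}"]
    by (simp only: Int_absorb1[OF s])
  then show ?thesis unfolding test_functions_def mem_Collect_eq
    using assms(1) subset_trans[OF s assms(3)] by blast
qed

lemma test_functionsE:
  assumes "\<phi> \<in> test_functions \<Omega>"
  obtains K where "compact K" "K \<subseteq> \<Omega>" "\<And>x. x \<notin> K \<Longrightarrow> \<phi> x = 0"
    "\<And>x. x \<notin> K \<Longrightarrow> gradient \<phi> x = 0" "\<And>i x. x \<notin> K \<Longrightarrow> partial_deriv i \<phi> x = 0"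
    "\<And>k. C_k k \<phi>" "continuous_on UNIV \<phi>" "continuous_on UNIV (gradient \<phi>)"
    "\<And>i. i \<in> Basis \<Longrightarrow> continuous_on UNIV (partial_deriv i \<phi>)"
    "\<And>x. (\<phi> has_derivative (\<lambda>h. gradient \<phi> x \<bullet> h)) (at x)"
proof -
  let ?K = "closure {x. \<phi> x \<noteq> 0}"
  have a: "(\<forall>k. C_k k \<phi>) \<and> compact ?K \<and> ?K \<subseteq> \<Omega>"
    using assms unfolding test_functions_def mem_Collect_eq .
  note K = a[THEN conjunct2, THEN conjunct1] a[THEN conjunct2, THEN conjunct2]
  have C: "C_k k \<phi>" for k using a by blast
  have z: "\<phi> x = 0" if "x \<notin> ?K" for x
    using that closure_subset[of "{x. \<phi> x \<noteq> 0}"] by auto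
  have g: "gradient \<phi> x = 0" "partial_deriv i \<phi> x = 0" if "x \<notin> ?K" for x i
    using gradient_eq_0_outside[OF _ z that] partial_deriv_eq_0_outside[OF _ z that] by auto
  have c: "continuous_on UNIV \<phi>" "continuous_on UNIV (gradient \<phi>)"
    using C_k_imp_continuous[OF C] continuous_gradient[OF C] by auto
  have p: "continuous_on UNIV (partial_deriv i \<phi>)" if "i \<in> Basis" for i
    using C[of 1] that by simp
  have d: "(\<phi> has_derivative (\<lambda>h. gradient \<phi> x \<bullet> h)) (at x)" for x
    by (intro gradient_has_derivative) (use C[of 1] in simp)
  show ?thesis by (rule that[OF K z g C c p d])
qed

lemma locally_integrable_continuous:
  fixes f :: "'a::euclidean_space \<Rightarrow> 'b::euclidean_space"
  assumes "continuous_on UNIV f"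
  shows "locally_integrable \<Omega> f"
  unfolding locally_integrable_def
proof safe
  fix K :: "'a set" assume K: "compact K"
  have i: "integrable lborel (\<lambda>x. indicator K x *\<^sub>R f x)"
    by (rule borel_integrable_compact[OF K continuous_on_subset[OF assms]]) auto
  then have "integrable lebesgue (\<lambda>x. indicator K x *\<^sub>R f x)"
    by (subst integrable_completion) auto
  then show "integrable (lebesgue_on K) f"
    using K by (subst integrable_restrict_space) (auto intro!: lmeasurable_compact fmeasurableD)
qed

lemma in_Lp_compact_support:
  fixes f :: "'a::euclidean_space \<Rightarrow> 'b::euclidean_space"
  assumes "open \<Omega>" "q > 0" "compact K" "K \<subseteq> \<Omega>" "continuous_on UNIV f" "\<And>x. x \<notin> K \<Longrightarrow> f x = 0"
  shows "in_Lp \<Omega> q f"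
  unfolding in_Lp_def
proof
  have "integrable lborel f"
    using assms by (intro integrable_compact_support[of K]) (auto intro: continuous_on_subset)
  then have "integrable (lebesgue_on \<Omega>) f"
    by (rule integrable_lebesgue_on_support(1)[rotated]) (use assms in auto)
  then show "f \<in> borel_measurable (lebesgue_on \<Omega>)" by simp
  have "integrable lborel (\<lambda>x. norm (f x) powr q)"
    using assms by (intro integrable_compact_support[of K] continuous_on_powr')
      (auto intro!: continuous_intros intro: continuous_on_subset)
  then show "integrable (lebesgue_on \<Omega>) (\<lambda>x. norm (f x) powr q)"
    by (rule integrable_lebesgue_on_support(1)[rotated]) (use assms in auto)
qed

text \<open>The derivative of the compactly supported product \<open>\<phi> x * \<psi> x\<close>
  integrates to 0. This identifies the classical gradient of a test function as its weak
  gradient.\<close>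

lemma integration_by_parts_test:
  assumes O: "open \<Omega>" and f: "\<phi> \<in> test_functions \<Omega>" and g: "\<psi> \<in> test_functions \<Omega>"
    and i: "i \<in> Basis"
  shows "(LINT x|lebesgue_on \<Omega>. \<phi> x * partial_deriv i \<psi> x) =
    - (LINT x|lebesgue_on \<Omega>. (gradient \<phi> x \<bullet> i) * \<psi> x)"
proof -
  obtain K where K: "compact K" "K \<subseteq> \<Omega>" "\<And>x. x \<notin> K \<Longrightarrow> \<phi> x = 0" "\<And>x. x \<notin> K \<Longrightarrow> gradient \<phi> x = 0"
    "\<And>k. C_k k \<phi>" "continuous_on UNIV \<phi>" "continuous_on UNIV (gradient \<phi>)"
    using f by (rule test_functionsE) (rule that)
  obtain K' where K': "\<And>k. C_k k \<psi>" "continuous_on UNIV \<psi>"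
    "\<And>i. i \<in> Basis \<Longrightarrow> continuous_on UNIV (partial_deriv i \<psi>)"
    using g by (rule test_functionsE) (rule that)
  let ?A = "\<lambda>x. \<phi> x * partial_deriv i \<psi> x" and ?B = "\<lambda>x. (gradient \<phi> x \<bullet> i) * \<psi> x"
  have A: "integrable lborel ?A" and B: "integrable lborel ?B"
    using K K' i by (auto intro!: integrable_compact_support[of K] continuous_on_subset[of UNIV _ K]
        continuous_intros)
  have "partial_deriv i (\<lambda>x. \<phi> x * \<psi> x) x = ?A x + ?B x" for x
    using K(5)[of 1] K'(1)[of 1] i by (simp add: partial_deriv_mult gradient_inner_Basis)
  moreover have "(\<integral>x. partial_deriv i (\<lambda>x. \<phi> x * \<psi> x) x \<partial>lborel) = 0"
    by (rule integral_partial_deriv_eq_0[of _ K]) (use K K' in \<open>auto simp del: C_k.simps intro: C_k_mult\<close>)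
  ultimately have "integral\<^sup>L lborel ?A = - integral\<^sup>L lborel ?B"
    using Bochner_Integration.integral_add[OF A B] by simp
  moreover have "x \<notin> \<Omega> \<Longrightarrow> \<phi> x = 0 \<and> gradient \<phi> x = 0" for x
    using K(2,3,4) by auto
  ultimately show ?thesis
    using O by (simp add: integrable_lebesgue_on_support(2)[OF _ A] integrable_lebesgue_on_support(2)[OF _ B])
qed

lemma test_functions_in_sobolev0:
  assumes O: "open \<Omega>" and f: "\<phi> \<in> test_functions \<Omega>" and q: "q > 0"
  shows "(\<phi>, gradient \<phi>) \<in> sobolev0 \<Omega> q"
proof -
  obtain K where K: "compact K" "K \<subseteq> \<Omega>" "\<And>x. x \<notin> K \<Longrightarrow> \<phi> x = 0" "\<And>x. x \<notin> K \<Longrightarrow> gradient \<phi> x = 0"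
    "continuous_on UNIV \<phi>" "continuous_on UNIV (gradient \<phi>)"
    using f by (rule test_functionsE) (rule that)
  have "has_weak_gradient \<Omega> \<phi> (gradient \<phi>)"
    unfolding has_weak_gradient_def
    using locally_integrable_continuous[OF K(5), of \<Omega>] locally_integrable_continuous[OF K(6), of \<Omega>]
      integration_by_parts_test[OF O f] by blast
  moreover have "in_Lp \<Omega> q \<phi>" "in_Lp \<Omega> q (gradient \<phi>)"
    using in_Lp_compact_support[OF O q K(1,2,5,3)] in_Lp_compact_support[OF O q K(1,2,6,4)] by auto
  ultimately show ?thesis
    using f by (auto simp: sobolev0_def sobolev_def sobolev_norm_def intro!: bexI[of _ \<phi>])
qed

text \<open>Ensures that the Hardy constant is an infimum over a nonempty set; without it lower
  bounds for the quotients would say nothing about \<open>Inf\<close>.\<close>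

lemma exists_nonzero_test_function:
  fixes \<Omega> :: "'a::euclidean_space set"
  assumes O: "open \<Omega>" "\<Omega> \<noteq> {}"
  obtains \<phi> where "\<phi> \<in> test_functions \<Omega>" "\<not> (AE x in lebesgue_on \<Omega>. \<phi> x = 0)"
proof -
  obtain z r where r: "r > 0" "cball z r \<subseteq> \<Omega>"
    using O by (metis all_not_in_conv open_contains_cball)
  have z: "bump z r x = 0" if "x \<notin> cball z r" for x
    using that r bump_nonneg[of z r x] bump_pos_iff[of r z x] by (auto simp: dist_commute less_le)
  have t: "bump z r \<in> test_functions \<Omega>"
    by (rule test_functionsI[OF C_k_bump compact_cball r(2) z])
  have "\<not> (AE x in lebesgue_on \<Omega>. bump z r x = 0)"
  proof
    assume "AE x in lebesgue_on \<Omega>. bump z r x = 0"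
    then have "AE x in lebesgue. x \<in> \<Omega> \<longrightarrow> bump z r x = 0"
      using O by (subst (asm) AE_restrict_space_iff) auto
    then have "AE x in lebesgue. x \<notin> ball z r"
      by eventually_elim
        (metis bump_pos_iff r less_irrefl mem_ball dist_commute ball_subset_cball subsetD)
    then have "ball z r \<in> null_sets lebesgue"
      by (subst (asm) AE_iff_null_sets[symmetric]) auto
    then have "negligible (ball z r)" by (simp add: negligible_iff_null_sets)
    then show False using r open_not_negligible[of "ball z r"] by simp
  qed
  with t show ?thesis using that by blast
qed

subsection \<open>Mollification\<close>

lemma uniformly_continuous_compact_support:
  fixes f :: "'a::euclidean_space \<Rightarrow> 'b::real_normed_vector"
  assumes K: "compact K" and f: "continuous_on UNIV f" "\<And>x. x \<notin> K \<Longrightarrow> f x = 0"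
    and e: "e > 0"
  obtains d where "d > 0" "\<And>x y. dist x y < d \<Longrightarrow> norm (f x - f y) < e"
proof -
  \<comment> \<open>Two points at distance less than 1 lie either both in this enlarged compact set
    or both outside \<open>K\<close>, where \<open>f\<close> vanishes.\<close>
  define K1 where "K1 = {x + y |x y. x \<in> K \<and> y \<in> cball 0 (1::real)}"
  have "compact K1" unfolding K1_def using K by (intro compact_sums) auto
  then have "uniformly_continuous_on K1 f"
    using f(1) continuous_on_subset by (intro compact_uniformly_continuous) auto
  then obtain d where d: "d > 0" "\<And>x y. x \<in> K1 \<Longrightarrow> y \<in> K1 \<Longrightarrow> dist x y < d \<Longrightarrow> dist (f x) (f y) < e"
    using e unfolding uniformly_continuous_on_def by (metis dist_commute)
  have near: "y \<in> K1" if "x \<in> K" "dist x y < 1" for x y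
    unfolding K1_def using that
    by (intro CollectI exI[of _ x] exI[of _ "y - x"]) (auto simp: dist_norm norm_minus_commute)
  have "norm (f x - f y) < e" if xy: "dist x y < min d 1" for x y
  proof (cases "x \<in> K \<or> y \<in> K")
    case True
    then have "x \<in> K1 \<and> y \<in> K1"
      using near[of x y] near[of y x] near[of x x] near[of y y] xy by (auto simp: dist_commute)
    then show ?thesis using d(2)[of x y] xy by (simp add: dist_norm)
  qed (use f(2) e in auto)
  then show ?thesis using that[of "min d 1"] d(1) by simp
qed

text \<open>The variable \<open>x\<close> occurs in the kernel only, so derivatives fall on
  \<open>k\<close> and continuity of \<open>v\<close> is enough for smoothness.\<close>

definition conv :: "('a::euclidean_space \<Rightarrow> real) \<Rightarrow> ('a \<Rightarrow> real) \<Rightarrow> 'a \<Rightarrow> real" where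
  "conv v k x = (\<integral>y. v y * k (x - y) \<partial>lborel)"

lemma integrable_conv:
  fixes f :: "'a::euclidean_space \<Rightarrow> 'b::euclidean_space"
  assumes "compact K" "continuous_on UNIV v" "\<And>x. x \<notin> K \<Longrightarrow> v x = 0" "continuous_on UNIV f"
  shows "integrable lborel (\<lambda>y. v y *\<^sub>R f (x - y))"
proof (rule integrable_compact_support[OF assms(1)])
  have "continuous_on K (\<lambda>y. f (x - y))"
    by (rule continuous_on_compose2[OF assms(4)]) (auto intro!: continuous_intros)
  then show "continuous_on K (\<lambda>y. v y *\<^sub>R f (x - y))"
    by (intro continuous_on_scaleR continuous_on_subset[OF assms(2)]) auto
qed (use assms(3) in simp)

text \<open>Differentiation under the integral sign. Uniform continuity of \<open>gradient k\<close>
  makes the linearization error of \<open>k\<close> at most \<open>e' * norm h\<close> at every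
  point simultaneously, and integration against \<open>\<bar>v y\<bar>\<close> preserves this up to
  the factor \<open>I\<close>.\<close>

lemma conv_has_derivative:
  fixes v k :: "'a::euclidean_space \<Rightarrow> real"
  assumes K: "compact K" and v: "continuous_on UNIV v" "\<And>x. x \<notin> K \<Longrightarrow> v x = 0"
    and C: "compact C" and k: "C_k 1 k" "\<And>x. x \<notin> C \<Longrightarrow> k x = 0"
  shows "(conv v k has_derivative (\<lambda>h. (\<integral>y. v y *\<^sub>R gradient k (x - y) \<partial>lborel) \<bullet> h)) (at x)"
  unfolding has_derivative_at_alt
proof (intro conjI allI impI bounded_linear_inner_right)
  fix e :: real assume e: "e > 0"
  have ck: "continuous_on UNIV k" and cg: "continuous_on UNIV (gradient k)"
    using C_k_imp_continuous[OF k(1)] continuous_gradient[of 0 k] k(1) by auto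
  have dk: "(k has_derivative (\<lambda>h. gradient k z \<bullet> h)) (at z)" for z
    by (intro gradient_has_derivative) (use k(1) in simp)
  have g0: "x \<notin> C \<Longrightarrow> gradient k x = 0" for x
    using gradient_eq_0_outside[OF compact_imp_closed[OF C] k(2)] by auto
  have iv: "integrable lborel (\<lambda>y. \<bar>v y\<bar>)"
    using v by (intro integrable_compact_support[OF K]) (auto intro!: continuous_intros intro: continuous_on_subset)
  define I where "I = (\<integral>y. \<bar>v y\<bar> \<partial>lborel)"
  have I: "I \<ge> 0" by (simp add: I_def)
  \<comment> \<open>\<open>I + 1\<close> instead of \<open>I\<close> avoids a division by 0 when
    \<open>v\<close> vanishes.\<close>
  define e' where "e' = e / (I + 1)"
  have e': "e' > 0" using e I by (simp add: e'_def)
  obtain d where d: "d > 0" "\<And>x y. dist x y < d \<Longrightarrow> norm (gradient k x - gradient k y) < e'"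
    using uniformly_continuous_compact_support[OF C cg g0 e'] by metis
  show "\<exists>d>0. \<forall>y. norm (y - x) < d \<longrightarrow>
      norm (conv v k y - conv v k x - (\<integral>y. v y *\<^sub>R gradient k (x - y) \<partial>lborel) \<bullet> (y - x)) \<le> e * norm (y - x)"
  proof (intro exI[of _ d] conjI allI impI d(1))
    fix z assume z: "norm (z - x) < d"
    let ?h = "z - x"
    have rem: "\<bar>k (w + ?h) - k w - gradient k w \<bullet> ?h\<bar> \<le> norm ?h * e'" for w
    proof -
      have "norm (k (w + ?h) - k w - gradient k w \<bullet> (w + ?h - w)) \<le> norm (w + ?h - w) * e'"
      proof (rule differentiable_bound_linearization[where S="ball w d" and f'="\<lambda>u h. gradient k u \<bullet> h"])
        show "w + t *\<^sub>R (w + ?h - w) \<in> ball w d" if "t \<in> {0..1}" for t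
        proof -
          have "\<bar>t\<bar> * norm ?h \<le> norm ?h" using that by (simp add: mult_left_le_one_le)
          then show ?thesis using z by (simp add: dist_norm)
        qed
        show "w \<in> ball w d" using d by simp
        fix u assume u: "u \<in> ball w d"
        show "(k has_derivative (\<lambda>h. gradient k u \<bullet> h)) (at u within ball w d)"
          using dk has_derivative_at_withinI by blast
        have "onorm (\<lambda>h. (gradient k u - gradient k w) \<bullet> h) \<le> e'"
          by (rule onorm_bound)
             (use e' d(2)[of u w] u in \<open>auto simp: dist_commute intro!: order_trans[OF Cauchy_Schwarz_ineq2] mult_right_mono\<close>)
        then show "onorm ((\<lambda>h. gradient k u \<bullet> h) - (\<lambda>h. gradient k w \<bullet> h)) \<le> e'"
          by (simp add: fun_diff_def inner_diff_left)
      qed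
      then show ?thesis by simp
    qed
    have i1: "integrable lborel (\<lambda>y. v y * k (z - y))" "integrable lborel (\<lambda>y. v y * k (x - y))"
      using integrable_conv[OF K v ck] by simp_all
    have i2: "integrable lborel (\<lambda>y. v y *\<^sub>R gradient k (x - y))"
      using integrable_conv[OF K v cg] .
    have i3: "integrable lborel (\<lambda>y. v y * (gradient k (x - y) \<bullet> ?h))"
      using integrable_inner_left[OF i2] by simp
    have eq: "conv v k z - conv v k x - (\<integral>y. v y *\<^sub>R gradient k (x - y) \<partial>lborel) \<bullet> ?h
      = (\<integral>y. v y * k (z - y) - v y * k (x - y) - v y * (gradient k (x - y) \<bullet> ?h) \<partial>lborel)"
      using i1 i3 integral_inner_left[OF i2, of ?h] by (simp add: conv_def)
    have "norm (conv v k z - conv v k x - (\<integral>y. v y *\<^sub>R gradient k (x - y) \<partial>lborel) \<bullet> ?h)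
      \<le> (\<integral>y. norm (v y * k (z - y) - v y * k (x - y) - v y * (gradient k (x - y) \<bullet> ?h)) \<partial>lborel)"
      unfolding eq by (rule integral_norm_bound)
    also have "\<dots> \<le> (\<integral>y. \<bar>v y\<bar> * (norm ?h * e') \<partial>lborel)"
    proof (rule integral_mono)
      fix y
      have "norm (v y * k (z - y) - v y * k (x - y) - v y * (gradient k (x - y) \<bullet> ?h))
        = \<bar>v y\<bar> * \<bar>k (x - y + ?h) - k (x - y) - gradient k (x - y) \<bullet> ?h\<bar>"
        by (simp add: abs_mult[symmetric] algebra_simps)
      also have "\<dots> \<le> \<bar>v y\<bar> * (norm ?h * e')"
        by (intro mult_left_mono rem) simp
      finally show "norm (v y * k (z - y) - v y * k (x - y) - v y * (gradient k (x - y) \<bullet> ?h)) \<le> \<bar>v y\<bar> * (norm ?h * e')" .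
    qed (use i1 i3 iv in auto)
    also have "\<dots> = I * (norm ?h * e')" by (simp add: I_def)
    also have "\<dots> \<le> e * norm ?h"
    proof -
      have "I * e' \<le> e" using e I by (simp add: e'_def field_simps)
      then show ?thesis by (metis mult.left_commute mult.commute mult_right_mono norm_ge_zero)
    qed
    finally show "norm (conv v k z - conv v k x - (\<integral>y. v y *\<^sub>R gradient k (x - y) \<partial>lborel) \<bullet> ?h) \<le> e * norm ?h" .
  qed
qed

lemma C_k_conv:
  fixes v k :: "'a::euclidean_space \<Rightarrow> real"
  assumes K: "compact K" and v: "continuous_on UNIV v" "\<And>x. x \<notin> K \<Longrightarrow> v x = 0"
    and C: "compact C" and k: "\<And>m. C_k m k" "\<And>x. x \<notin> C \<Longrightarrow> k x = 0"
  shows "C_k n (conv v k)"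
  using k
proof (induction n arbitrary: k)
  case 0
  then show ?case
    using has_derivative_continuous[OF conv_has_derivative[OF K v C 0(1) 0(2)]]
    by (auto intro!: continuous_at_imp_continuous_on)
next
  case (Suc n)
  note D = conv_has_derivative[OF K v C Suc.prems(1) Suc.prems(2)]
  have cg: "continuous_on UNIV (gradient k)"
    using continuous_gradient[OF Suc.prems(1)] .
  have P: "partial_deriv i (conv v k) = conv v (partial_deriv i k)" if i: "i \<in> Basis" for i
  proof
    fix x
    show "partial_deriv i (conv v k) x = conv v (partial_deriv i k) x"
      using partial_deriv_eqI[OF D, of i x] integral_inner_left[OF integrable_conv[OF K v cg], of i x] i
      by (simp add: conv_def gradient_inner_Basis)
  qed
  have "C_k n (conv v (partial_deriv i k))" if "i \<in> Basis" for i
  proof (rule Suc.IH)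
    show "C_k m (partial_deriv i k)" for m using Suc.prems(1)[of "Suc m"] that by simp
    show "x \<notin> C \<Longrightarrow> partial_deriv i k x = 0" for x
      using partial_deriv_eq_0_outside[OF compact_imp_closed[OF C] Suc.prems(2)] by auto
  qed
  then show ?case using D P by (auto intro: differentiableI)
qed

text \<open>The derivative in the direction of the gradient \<open>g\<close> itself is
  \<open>g \<bullet> g\<close>, while the Lipschitz bound caps it by
  \<open>L * norm g\<close>.\<close>

lemma gradient_norm_le_Lipschitz:
  assumes d: "(f has_derivative (\<lambda>h. g \<bullet> h)) (at x)"
    and r: "r > 0" and L: "\<And>y. y \<in> ball x r \<Longrightarrow> \<bar>f y - f x\<bar> \<le> L * dist y x" "L \<ge> 0"
  shows "norm g \<le> L"
proof (cases "g = 0")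
  case False
  have "((\<lambda>t. f (x + t *\<^sub>R g)) has_derivative (\<lambda>t. g \<bullet> (t *\<^sub>R g))) (at 0)"
  proof (rule has_derivative_compose[where g=f])
    show "((\<lambda>t. x + t *\<^sub>R g) has_derivative (\<lambda>t. t *\<^sub>R g)) (at 0)"
      by (auto intro!: derivative_eq_intros)
  qed (use d in simp)
  moreover have "(\<lambda>t. g \<bullet> (t *\<^sub>R g)) = (*) (g \<bullet> g)" by (auto simp: mult.commute)
  ultimately have "((\<lambda>t. f (x + t *\<^sub>R g)) has_real_derivative (g \<bullet> g)) (at 0)"
    by (simp only: has_field_derivative_def)
  then have lim: "((\<lambda>t. (f (x + t *\<^sub>R g) - f x) / t) \<longlongrightarrow> g \<bullet> g) (at 0)"
    by (simp add: DERIV_def)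
  have "eventually (\<lambda>t::real. t \<in> ball 0 (r / norm g) - {0}) (at 0)"
    unfolding eventually_at using False r by (intro exI[of _ "r / norm g"]) auto
  then have "eventually (\<lambda>t. (f (x + t *\<^sub>R g) - f x) / t \<le> L * norm g) (at 0)"
  proof eventually_elim
    case (elim t)
    have "\<bar>f (x + t *\<^sub>R g) - f x\<bar> \<le> L * (\<bar>t\<bar> * norm g)"
      using L(1)[of "x + t *\<^sub>R g"] elim False by (simp add: dist_norm field_simps)
    then have "\<bar>(f (x + t *\<^sub>R g) - f x) / t\<bar> \<le> L * norm g"
      using elim by (simp add: abs_divide field_simps)
    then show ?case by linarith
  qed
  then have "g \<bullet> g \<le> L * norm g"
    by (rule tendsto_upperbound[OF lim]) simp
  then show ?thesis using False by (simp add: power2_norm_eq_inner[symmetric] power2_eq_square)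
qed (use L in simp)

text \<open>\<open>w\<close> averages \<open>v\<close> over balls of radius
  \<open>\<epsilon>\<close> with a probability density, so bounds for \<open>v\<close> on such a
  ball survive. The free constant \<open>c\<close> lets one property serve three purposes:
  \<open>c = 0\<close> controls the support and the size of \<open>w\<close>, and
  \<open>c = v x\<close> gives convergence. The radius \<open>\<epsilon> + r\<close> in the last
  property accounts for comparing \<open>w\<close> at \<open>x\<close> with its values within
  distance \<open>r\<close>.\<close>

lemma mollification:
  fixes v :: "'a::euclidean_space \<Rightarrow> real"
  assumes K: "compact K" and v: "continuous_on UNIV v" "\<And>x. x \<notin> K \<Longrightarrow> v x = 0" and e: "\<epsilon> > 0"
  obtains w where "\<And>n. C_k n w"
    and "\<And>x c \<eta>. (\<And>y. dist y x \<le> \<epsilon> \<Longrightarrow> \<bar>v y - c\<bar> \<le> \<eta>) \<Longrightarrow> \<bar>w x - c\<bar> \<le> \<eta>"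
    and "\<And>x L r. r > 0 \<Longrightarrow> L \<ge> 0 \<Longrightarrow>
      (\<And>y z. y \<in> ball x (\<epsilon> + r) \<Longrightarrow> z \<in> ball x (\<epsilon> + r) \<Longrightarrow> \<bar>v y - v z\<bar> \<le> L * dist y z) \<Longrightarrow>
      norm (gradient w x) \<le> L"
proof -
  let ?b = "bump (0::'a) \<epsilon>"
  let ?C = "cball (0::'a) \<epsilon>"
  have b0: "?b y = 0" if "y \<notin> ?C" for y
    using that e bump_nonneg[of 0 \<epsilon> y] bump_pos_iff[of \<epsilon> 0 y] by (auto simp: dist_commute less_le)
  have cb: "continuous_on UNIV ?b" using C_k_imp_continuous[OF C_k_bump[of 0]] .
  have ib: "integrable lborel ?b"
    using b0 cb by (intro integrable_compact_support[of ?C]) (auto intro: continuous_on_subset)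
  define I where "I = integral\<^sup>L lborel ?b"
  have "I \<noteq> 0"
  proof
    assume "I = 0"
    then have "AE x in lborel. ?b x = 0"
      using integral_nonneg_eq_0_iff_AE[OF ib AE_I2[OF bump_nonneg]] by (simp add: I_def)
    then have "AE x in lborel. x \<notin> ball (0::'a) \<epsilon>"
      by eventually_elim (metis bump_pos_iff e less_irrefl mem_ball dist_commute)
    then have "ball (0::'a) \<epsilon> \<in> null_sets lborel"
      by (subst (asm) AE_iff_null_sets[symmetric]) auto
    then have "negligible (ball (0::'a) \<epsilon>)"
      by (simp add: negligible_iff_null_sets null_sets_completionI)
    then show False using e open_not_negligible[of "ball (0::'a) \<epsilon>"] by simp
  qed
  moreover have "I \<ge> 0" by (simp add: I_def bump_nonneg)
  ultimately have I: "I > 0" by simp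
  define k where "k = (\<lambda>x. (1 / I) * ?b x)"
  have Ck: "C_k n k" for n unfolding k_def by (intro C_k_mult C_k_const C_k_bump)
  have k0: "k y = 0" if "y \<notin> ?C" for y using b0[OF that] by (simp add: k_def)
  have kpos: "k y \<ge> 0" for y using I bump_nonneg[of 0 \<epsilon> y] by (simp add: k_def)
  have ik: "integrable lborel k" and int_k: "integral\<^sup>L lborel k = 1"
    using ib I by (simp_all add: k_def I_def)
  have mk: "k \<in> borel_measurable borel" using ik by auto
  have mv: "v \<in> borel_measurable borel" using v(1) by (rule borel_measurable_continuous_onI)
  let ?w = "conv v k"
  \<comment> \<open>Smoothness is read off with \<open>x\<close> in the kernel; reflection moves
    \<open>x\<close> into \<open>v\<close>, so that differences of \<open>?w\<close> become averages
    of differences of \<open>v\<close>.\<close>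
  have im: "integrable lborel (\<lambda>y. v (x - y) * k y)" and w: "?w x = (\<integral>y. v (x - y) * k y \<partial>lborel)" for x
  proof -
    have m: "(\<lambda>y. v y * k (x - y)) \<in> borel_measurable borel" using mk mv by measurable
    have "integrable lborel (\<lambda>y. v y * k (x - y))"
      using integrable_conv[OF K v C_k_imp_continuous[OF Ck]] by simp
    then show "integrable lborel (\<lambda>y. v (x - y) * k y)" "?w x = (\<integral>y. v (x - y) * k y \<partial>lborel)"
      using lborel_integral_reflection[OF m, of x] by (simp_all add: conv_def)
  qed
  have Cw: "C_k n ?w" for n by (rule C_k_conv[OF K v compact_cball Ck k0])
  have bound: "\<bar>\<integral>y. f y * k y \<partial>lborel\<bar> \<le> \<eta>"
    if f: "integrable lborel (\<lambda>y. f y * k y)" "\<And>y. norm y \<le> \<epsilon> \<Longrightarrow> \<bar>f y\<bar> \<le> \<eta>" for f \<eta>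
  proof -
    have "\<bar>\<integral>y. f y * k y \<partial>lborel\<bar> \<le> (\<integral>y. norm (f y * k y) \<partial>lborel)"
      using integral_norm_bound[of lborel "\<lambda>y. f y * k y"] by simp
    also have "\<dots> \<le> (\<integral>y. \<eta> * k y \<partial>lborel)"
    proof (rule integral_mono)
      fix y
      show "norm (f y * k y) \<le> \<eta> * k y"
        using f(2)[of y] k0[of y] kpos[of y] by (cases "y \<in> ?C") (auto simp: abs_mult intro: mult_right_mono)
    qed (use f ik in auto)
    finally show ?thesis by (simp add: int_k)
  qed
  show ?thesis
  proof (rule that[of ?w])
    show "C_k n ?w" for n by (rule Cw)
    show "\<bar>?w x - c\<bar> \<le> \<eta>" if h: "\<And>y. dist y x \<le> \<epsilon> \<Longrightarrow> \<bar>v y - c\<bar> \<le> \<eta>" for x c \<eta>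
    proof -
      have "?w x - c = (\<integral>y. v (x - y) * k y - c * k y \<partial>lborel)"
        using im[of x] ik by (simp add: w int_k)
      also have "\<dots> = (\<integral>y. (v (x - y) - c) * k y \<partial>lborel)"
        by (simp add: left_diff_distrib)
      finally show ?thesis
        using bound[of "\<lambda>y. v (x - y) - c" \<eta>] im[of x] ik h
        by (simp add: left_diff_distrib dist_norm)
    qed
    show "norm (gradient ?w x) \<le> L" if r: "r > 0" and L: "L \<ge> 0"
      and h: "\<And>y z. y \<in> ball x (\<epsilon> + r) \<Longrightarrow> z \<in> ball x (\<epsilon> + r) \<Longrightarrow> \<bar>v y - v z\<bar> \<le> L * dist y z" for x L r
    proof (rule gradient_norm_le_Lipschitz[OF _ r _ L])
      show "(?w has_derivative (\<lambda>h. gradient ?w x \<bullet> h)) (at x)"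
        by (intro gradient_has_derivative) (use Cw[of 1] in simp)
      fix y assume y: "y \<in> ball x r"
      have "?w y - ?w x = (\<integral>t. (v (y - t) - v (x - t)) * k t \<partial>lborel)"
        using im by (simp add: w left_diff_distrib)
      moreover have "\<bar>v (y - t) - v (x - t)\<bar> \<le> L * dist y x" if t: "norm t \<le> \<epsilon>" for t
      proof -
        have "dist x (y - t) \<le> dist x y + norm t" "dist x (x - t) = norm t"
          using norm_triangle_ineq[of "x - y" t] by (simp_all add: dist_norm algebra_simps)
        then have "\<bar>v (y - t) - v (x - t)\<bar> \<le> L * dist (y - t) (x - t)"
          using t y r by (intro h) auto
        then show ?thesis by (simp add: dist_norm)
      qed
      ultimately show "\<bar>?w y - ?w x\<bar> \<le> L * dist y x"
        using bound[of "\<lambda>t. v (y - t) - v (x - t)" "L * dist y x"] im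
        by (simp add: left_diff_distrib)
    qed
  qed
qed

subsection \<open>Pointwise Lipschitz constants\<close>

text \<open>A substitute for an upper bound on the norm of the gradient that makes sense at every
  point of a nonsmooth function. Both \<open>y\<close> and \<open>z\<close> move, unlike in a
  difference quotient based at \<open>x\<close>: this is what survives averaging over small balls.
  \<open>L\<close> is only an upper bound, so any larger value is admissible as well.\<close>

definition lip_at :: "('a::metric_space \<Rightarrow> real) \<Rightarrow> 'a \<Rightarrow> real \<Rightarrow> bool" where
  "lip_at f x L \<longleftrightarrow>
    (\<forall>\<eta>>0. \<exists>r>0. \<forall>y\<in>ball x r. \<forall>z\<in>ball x r. \<bar>f y - f z\<bar> \<le> (L + \<eta>) * dist y z)"

lemma lip_atD:
  assumes "lip_at f x L" "\<eta> > 0"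
  obtains r where "r > 0" "\<And>y z. y \<in> ball x r \<Longrightarrow> z \<in> ball x r \<Longrightarrow> \<bar>f y - f z\<bar> \<le> (L + \<eta>) * dist y z"
proof -
  from assms(1)[unfolded lip_at_def, rule_format, OF assms(2)]
  obtain r where "r > 0" "\<forall>y\<in>ball x r. \<forall>z\<in>ball x r. \<bar>f y - f z\<bar> \<le> (L + \<eta>) * dist y z"
    by (elim exE conjE)
  then show ?thesis by (intro that[of r]) auto
qed

lemma lip_at_cong:
  assumes "lip_at f x L" "r > 0" "\<And>y. y \<in> ball x r \<Longrightarrow> g y = f y"
  shows "lip_at g x L"
  unfolding lip_at_def
proof (intro allI impI)
  fix \<eta> :: real assume "\<eta> > 0"
  obtain s where "s > 0" "\<And>y z. y \<in> ball x s \<Longrightarrow> z \<in> ball x s \<Longrightarrow> \<bar>f y - f z\<bar> \<le> (L + \<eta>) * dist y z"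
    by (rule lip_atD[OF assms(1) \<open>\<eta> > 0\<close>]) (rule that)
  then show "\<exists>r>0. \<forall>y\<in>ball x r. \<forall>z\<in>ball x r. \<bar>g y - g z\<bar> \<le> (L + \<eta>) * dist y z"
    using assms(2,3) by (intro exI[of _ "min r s"]) auto
qed

lemma lip_at_const: "lip_at (\<lambda>_. c) x 0"
  unfolding lip_at_def by (auto intro!: exI[of _ 1])

lemma lip_at_isCont:
  assumes "lip_at f x L"
  shows "isCont f x"
proof -
  obtain r where r: "r > 0" "\<And>y z. y \<in> ball x r \<Longrightarrow> z \<in> ball x r \<Longrightarrow> \<bar>f y - f z\<bar> \<le> (L + 1) * dist y z"
    by (rule lip_atD[OF assms zero_less_one]) (rule that)
  have "((\<lambda>y. f y - f x) \<longlongrightarrow> 0) (at x)"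
  proof (rule Lim_null_comparison)
    show "\<forall>\<^sub>F y in at x. norm (f y - f x) \<le> (L + 1) * dist y x"
      using r by (auto simp: eventually_at dist_commute intro!: exI[of _ r])
    show "((\<lambda>y. (L + 1) * dist y x) \<longlongrightarrow> 0) (at x)"
      by (auto intro!: tendsto_eq_intros)
  qed
  then show ?thesis by (simp add: isCont_def LIM_zero_iff)
qed

text \<open>The error terms in the rules below are continuous functions of a common tolerance \<open>\<delta>\<close>.\<close>

lemma lip_atI_tendsto:
  assumes "\<And>\<delta>. \<delta> > 0 \<Longrightarrow> \<exists>r>0. \<forall>y\<in>ball x r. \<forall>z\<in>ball x r. \<bar>f y - f z\<bar> \<le> g \<delta> * dist y z"
    and "(g \<longlongrightarrow> L) (at_right (0::real))"
  shows "lip_at f x L"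
  unfolding lip_at_def
proof (intro allI impI)
  fix \<eta> :: real assume "\<eta> > 0"
  then have "eventually (\<lambda>\<delta>. g \<delta> < L + \<eta>) (at_right 0)"
    using assms(2) by (intro order_tendstoD) auto
  moreover have "eventually (\<lambda>\<delta>::real. \<delta> > 0) (at_right 0)"
    by (simp add: eventually_at_right_less)
  ultimately have "eventually (\<lambda>\<delta>. g \<delta> < L + \<eta> \<and> \<delta> > 0) (at_right 0)"
    by (rule eventually_conj)
  from eventually_happens'[OF _ this] obtain \<delta> where d: "g \<delta> < L + \<eta>" "\<delta> > 0"
    by auto
  obtain r where r: "r > 0" "\<forall>y\<in>ball x r. \<forall>z\<in>ball x r. \<bar>f y - f z\<bar> \<le> g \<delta> * dist y z"
    using assms(1)[OF d(2)] by (elim exE conjE)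
  have "g \<delta> * dist y z \<le> (L + \<eta>) * dist y z" for y z :: 'a
    using d(1) by (intro mult_right_mono) auto
  with r show "\<exists>r>0. \<forall>y\<in>ball x r. \<forall>z\<in>ball x r. \<bar>f y - f z\<bar> \<le> (L + \<eta>) * dist y z"
    using order_trans by (intro exI[of _ r] conjI ballI) blast+
qed

lemma lip_at_near:
  assumes "lip_at f x L" "\<delta> > 0"
  obtains r where "r > 0" "\<And>y z. y \<in> ball x r \<Longrightarrow> z \<in> ball x r \<Longrightarrow> \<bar>f y - f z\<bar> \<le> (L + \<delta>) * dist y z"
    "\<And>y. y \<in> ball x r \<Longrightarrow> \<bar>f y - f x\<bar> < \<delta>"
proof -
  obtain r where r: "r > 0" "\<And>y z. y \<in> ball x r \<Longrightarrow> z \<in> ball x r \<Longrightarrow> \<bar>f y - f z\<bar> \<le> (L + \<delta>) * dist y z"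
    by (rule lip_atD[OF assms]) (rule that)
  obtain s where s: "s > 0" "\<And>y. y \<in> ball x s \<Longrightarrow> \<bar>f y - f x\<bar> < \<delta>"
    using lip_at_isCont[OF assms(1)] assms(2)
    unfolding continuous_at_eps_delta by (metis dist_commute dist_real_def mem_ball)
  show ?thesis by (rule that[of "min r s"]) (use r s in auto)
qed

text \<open>The Leibniz rule with absolute values, which is all that upper bounds can
  retain.\<close>

lemma lip_at_mult:
  assumes f: "lip_at f x L" and g: "lip_at g x M" and "L \<ge> 0" "M \<ge> 0"
  shows "lip_at (\<lambda>y. f y * g y) x (\<bar>f x\<bar> * M + \<bar>g x\<bar> * L)"
proof (rule lip_atI_tendsto)
  show "((\<lambda>\<delta>. (\<bar>f x\<bar> + \<delta>) * (M + \<delta>) + (\<bar>g x\<bar> + \<delta>) * (L + \<delta>)) \<longlongrightarrow> \<bar>f x\<bar> * M + \<bar>g x\<bar> * L) (at_right 0)"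
    by (auto intro!: tendsto_eq_intros)
  fix \<delta> :: real assume d: "\<delta> > 0"
  obtain r where r: "r > 0" "\<And>y z. y \<in> ball x r \<Longrightarrow> z \<in> ball x r \<Longrightarrow> \<bar>f y - f z\<bar> \<le> (L + \<delta>) * dist y z"
    "\<And>y. y \<in> ball x r \<Longrightarrow> \<bar>f y - f x\<bar> < \<delta>"
    by (rule lip_at_near[OF f d]) (rule that)
  obtain s where s: "s > 0" "\<And>y z. y \<in> ball x s \<Longrightarrow> z \<in> ball x s \<Longrightarrow> \<bar>g y - g z\<bar> \<le> (M + \<delta>) * dist y z"
    "\<And>y. y \<in> ball x s \<Longrightarrow> \<bar>g y - g x\<bar> < \<delta>"
    by (rule lip_at_near[OF g d]) (rule that)
  show "\<exists>r>0. \<forall>y\<in>ball x r. \<forall>z\<in>ball x r. \<bar>f y * g y - f z * g z\<bar>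
      \<le> ((\<bar>f x\<bar> + \<delta>) * (M + \<delta>) + (\<bar>g x\<bar> + \<delta>) * (L + \<delta>)) * dist y z"
  proof (intro exI[of _ "min r s"] conjI ballI)
    fix y z assume yz: "y \<in> ball x (min r s)" "z \<in> ball x (min r s)"
    have "\<bar>f y\<bar> \<le> \<bar>f x\<bar> + \<delta>" "\<bar>g z\<bar> \<le> \<bar>g x\<bar> + \<delta>"
      using r(3)[of y] s(3)[of z] yz by auto
    then have "\<bar>f y\<bar> * \<bar>g y - g z\<bar> \<le> (\<bar>f x\<bar> + \<delta>) * ((M + \<delta>) * dist y z)"
      "\<bar>g z\<bar> * \<bar>f y - f z\<bar> \<le> (\<bar>g x\<bar> + \<delta>) * ((L + \<delta>) * dist y z)"
      using r(2)[of y z] s(2)[of y z] yz d by (auto intro!: mult_mono)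
    moreover have "f y * g y - f z * g z = f y * (g y - g z) + g z * (f y - f z)"
      by (simp add: algebra_simps)
    then have "\<bar>f y * g y - f z * g z\<bar> \<le> \<bar>f y\<bar> * \<bar>g y - g z\<bar> + \<bar>g z\<bar> * \<bar>f y - f z\<bar>"
      by (metis abs_mult abs_triangle_ineq)
    ultimately show "\<bar>f y * g y - f z * g z\<bar>
      \<le> ((\<bar>f x\<bar> + \<delta>) * (M + \<delta>) + (\<bar>g x\<bar> + \<delta>) * (L + \<delta>)) * dist y z"
      unfolding distrib_right[of _ _ "dist y z"] mult.assoc by linarith
  qed (use r s in auto)
qed

lemma lip_at_compose:
  assumes f: "lip_at f x L" and h: "lip_at h (f x) M" and "L \<ge> 0" "M \<ge> 0"
  shows "lip_at (\<lambda>y. h (f y)) x (M * L)"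
proof (rule lip_atI_tendsto)
  show "((\<lambda>\<delta>. (M + \<delta>) * (L + \<delta>)) \<longlongrightarrow> M * L) (at_right 0)"
    by (auto intro!: tendsto_eq_intros)
  fix \<delta> :: real assume d: "\<delta> > 0"
  obtain s where s: "s > 0" "\<And>y z. y \<in> ball (f x) s \<Longrightarrow> z \<in> ball (f x) s \<Longrightarrow> \<bar>h y - h z\<bar> \<le> (M + \<delta>) * dist y z"
    by (rule lip_atD[OF h d]) (rule that)
  \<comment> \<open>The tolerance \<open>min \<delta> s\<close> serves twice: being at most
    \<open>\<delta>\<close> it bounds the slope of \<open>f\<close>, being at most \<open>s\<close>
    it keeps the values of \<open>f\<close> in the ball on which \<open>h\<close> is
    controlled.\<close>
  obtain r where r: "r > 0" "\<And>y z. y \<in> ball x r \<Longrightarrow> z \<in> ball x r \<Longrightarrow> \<bar>f y - f z\<bar> \<le> (L + min \<delta> s) * dist y z"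
    "\<And>y. y \<in> ball x r \<Longrightarrow> \<bar>f y - f x\<bar> < min \<delta> s"
    by (rule lip_at_near[OF f, of "min \<delta> s"]) (use d s(1) that in auto)
  show "\<exists>r>0. \<forall>y\<in>ball x r. \<forall>z\<in>ball x r. \<bar>h (f y) - h (f z)\<bar> \<le> (M + \<delta>) * (L + \<delta>) * dist y z"
  proof (intro exI[of _ r] conjI ballI r(1))
    fix y z assume yz: "y \<in> ball x r" "z \<in> ball x r"
    have "\<bar>f y - f z\<bar> \<le> (L + min \<delta> s) * dist y z" using r(2) yz by blast
    also have "\<dots> \<le> (L + \<delta>) * dist y z" by (intro mult_right_mono) auto
    finally have "(M + \<delta>) * \<bar>f y - f z\<bar> \<le> (M + \<delta>) * ((L + \<delta>) * dist y z)"
      using assms d by (intro mult_left_mono) auto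
    moreover have "\<bar>h (f y) - h (f z)\<bar> \<le> (M + \<delta>) * dist (f y) (f z)"
      using r(3)[of y] r(3)[of z] yz by (intro s(2)) (auto simp: dist_real_def abs_minus_commute)
    ultimately show "\<bar>h (f y) - h (f z)\<bar> \<le> (M + \<delta>) * (L + \<delta>) * dist y z"
      by (simp add: dist_real_def mult.assoc)
  qed
qed

text \<open>Continuity of the gradient at \<open>x\<close> bounds it by
  \<open>norm (g x) + \<eta>\<close> on a whole ball, and the mean value inequality on this convex
  set handles two moving points.\<close>

lemma lip_at_C1:
  fixes f :: "'a::euclidean_space \<Rightarrow> real"
  assumes d: "\<And>y. y \<in> ball x \<rho> \<Longrightarrow> (f has_derivative (\<lambda>h. g y \<bullet> h)) (at y)" "\<rho> > 0" and c: "isCont g x"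
  shows "lip_at f x (norm (g x))"
  unfolding lip_at_def
proof (intro allI impI)
  fix \<eta> :: real assume "\<eta> > 0"
  then obtain r where r: "r > 0" "\<And>y. dist y x < r \<Longrightarrow> dist (g y) (g x) < \<eta>"
    using c unfolding continuous_at_eps_delta by blast
  have o: "onorm (\<lambda>h. g y \<bullet> h) \<le> norm (g x) + \<eta>" if "y \<in> ball x r" for y
  proof -
    have "norm (g y) \<le> norm (g x) + \<eta>"
      using r(2)[of y] that norm_triangle_sub[of "g y" "g x"] by (simp add: dist_norm norm_minus_commute)
    then show ?thesis
      by (intro onorm_bound) (use \<open>\<eta> > 0\<close> in \<open>auto intro!: order_trans[OF Cauchy_Schwarz_ineq2] mult_right_mono\<close>)
  qed
  show "\<exists>r>0. \<forall>y\<in>ball x r. \<forall>z\<in>ball x r. \<bar>f y - f z\<bar> \<le> (norm (g x) + \<eta>) * dist y z"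
  proof (intro exI[of _ "min r \<rho>"] conjI ballI)
    fix y z assume "y \<in> ball x (min r \<rho>)" "z \<in> ball x (min r \<rho>)"
    then have "norm (f y - f z) \<le> (norm (g x) + \<eta>) * norm (y - z)"
      using d(1) o
      by (intro differentiable_bound[of "ball x (min r \<rho>)" f "\<lambda>y h. g y \<bullet> h"])
         (auto intro: has_derivative_at_withinI)
    then show "\<bar>f y - f z\<bar> \<le> (norm (g x) + \<eta>) * dist y z" by (simp add: dist_norm)
  qed (use r d in auto)
qed

section \<open>Local Lipschitz bounds for powers and for the distance\<close>

lemma powr_diff_le:
  fixes s t a :: real
  assumes "0 \<le> s" "s \<le> t" "a > 1"
  shows "t powr a - s powr a \<le> a * t powr (a - 1) * (t - s)"
proof (cases "s = t")
  case False
  then have st: "s < t" using assms by simp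
  have "\<exists>l z. s < z \<and> z < t \<and> ((\<lambda>u. u powr a) has_real_derivative l) (at z) \<and> t powr a - s powr a = (t - s) * l"
  proof (rule MVT[OF st])
    \<comment> \<open>Differentiability is demanded only strictly between the endpoints, so
      \<open>s = 0\<close> is allowed.\<close>
    show "continuous_on {s..t} (\<lambda>u. u powr a)"
      using assms by (intro continuous_on_powr') (auto intro: continuous_intros)
    show "(\<lambda>u. u powr a) differentiable (at x)" if "s < x" "x < t" for x
      using that assms has_real_derivative_powr[of x a] by (auto simp: real_differentiable_def)
  qed
  then obtain l z where z: "s < z" "z < t" "((\<lambda>u. u powr a) has_real_derivative l) (at z)"
    "t powr a - s powr a = (t - s) * l" by blast
  then have "l = a * z powr (a - 1)"
    using has_real_derivative_powr[of z a] assms DERIV_unique by fastforce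
  also have "\<dots> \<le> a * t powr (a - 1)"
    using z assms by (intro mult_left_mono powr_mono2) auto
  finally show ?thesis using z(4) st by (simp add: mult.commute mult_left_mono)
qed simp

lemma abs_powr_diff_le:
  fixes s t a m :: real
  assumes "\<bar>s\<bar> \<le> m" "\<bar>t\<bar> \<le> m" "a > 1"
  shows "\<bar>\<bar>s\<bar> powr a - \<bar>t\<bar> powr a\<bar> \<le> a * m powr (a - 1) * \<bar>s - t\<bar>"
proof -
  have *: "\<bar>\<bar>u\<bar> powr a - \<bar>w\<bar> powr a\<bar> \<le> a * m powr (a - 1) * \<bar>u - w\<bar>"
    if "\<bar>u\<bar> \<le> m" "\<bar>w\<bar> \<le> \<bar>u\<bar>" for u w
  proof -
    have "\<bar>w\<bar> powr a \<le> \<bar>u\<bar> powr a" using that assms by (intro powr_mono2) auto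
    then have "\<bar>\<bar>u\<bar> powr a - \<bar>w\<bar> powr a\<bar> \<le> a * \<bar>u\<bar> powr (a - 1) * (\<bar>u\<bar> - \<bar>w\<bar>)"
      using powr_diff_le[of "\<bar>w\<bar>" "\<bar>u\<bar>" a] that assms by simp
    also have "\<dots> \<le> a * m powr (a - 1) * \<bar>u - w\<bar>"
      using that assms by (intro mult_mono powr_mono2 mult_left_mono) auto
    finally show ?thesis .
  qed
  show ?thesis
    using *[of s t] *[of t s] assms by (cases "\<bar>t\<bar> \<le> \<bar>s\<bar>") (auto simp: abs_minus_commute)
qed

text \<open>Zeros of \<open>f\<close> need no separate treatment: since \<open>a > 1\<close>, the
  power of the absolute value has a continuous derivative vanishing at 0, and the bound is then
  0.\<close>

lemma lip_at_abs_powr: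
  assumes f: "lip_at f x L" and "L \<ge> 0" "a > 1"
  shows "lip_at (\<lambda>y. \<bar>f y\<bar> powr a) x (a * \<bar>f x\<bar> powr (a - 1) * L)"
proof (rule lip_atI_tendsto)
  have "((\<lambda>\<delta>. (\<bar>f x\<bar> + \<delta>) powr (a - 1)) \<longlongrightarrow> (\<bar>f x\<bar> + 0) powr (a - 1)) (at_right 0)"
    using assms by (intro tendsto_powr' tendsto_intros)
      (auto simp: eventually_at_right_less intro: eventually_mono[OF eventually_at_right_less[of 0]])
  then have "((\<lambda>\<delta>. a * (\<bar>f x\<bar> + \<delta>) powr (a - 1) * (L + \<delta>)) \<longlongrightarrow> a * (\<bar>f x\<bar> + 0) powr (a - 1) * (L + 0)) (at_right 0)"
    by (intro tendsto_mult tendsto_add tendsto_const tendsto_ident_at)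
  then show "((\<lambda>\<delta>. a * (\<bar>f x\<bar> + \<delta>) powr (a - 1) * (L + \<delta>)) \<longlongrightarrow> a * \<bar>f x\<bar> powr (a - 1) * L) (at_right 0)"
    by simp
  fix \<delta> :: real assume d: "\<delta> > 0"
  obtain r where r: "r > 0" "\<And>y z. y \<in> ball x r \<Longrightarrow> z \<in> ball x r \<Longrightarrow> \<bar>f y - f z\<bar> \<le> (L + \<delta>) * dist y z"
    "\<And>y. y \<in> ball x r \<Longrightarrow> \<bar>f y - f x\<bar> < \<delta>"
    by (rule lip_at_near[OF f d]) (rule that)
  show "\<exists>r>0. \<forall>y\<in>ball x r. \<forall>z\<in>ball x r. \<bar>\<bar>f y\<bar> powr a - \<bar>f z\<bar> powr a\<bar>
      \<le> a * (\<bar>f x\<bar> + \<delta>) powr (a - 1) * (L + \<delta>) * dist y z"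
  proof (intro exI[of _ r] conjI ballI r(1))
    fix y z assume yz: "y \<in> ball x r" "z \<in> ball x r"
    have "\<bar>f y\<bar> \<le> \<bar>f x\<bar> + \<delta>" "\<bar>f z\<bar> \<le> \<bar>f x\<bar> + \<delta>"
      using r(3)[of y] r(3)[of z] yz by auto
    then have "\<bar>\<bar>f y\<bar> powr a - \<bar>f z\<bar> powr a\<bar> \<le> a * (\<bar>f x\<bar> + \<delta>) powr (a - 1) * \<bar>f y - f z\<bar>"
      using assms by (intro abs_powr_diff_le) auto
    also have "\<dots> \<le> a * (\<bar>f x\<bar> + \<delta>) powr (a - 1) * ((L + \<delta>) * dist y z)"
      using r(2)[OF yz] assms by (intro mult_left_mono) auto
    finally show "\<bar>\<bar>f y\<bar> powr a - \<bar>f z\<bar> powr a\<bar> \<le> a * (\<bar>f x\<bar> + \<delta>) powr (a - 1) * (L + \<delta>) * dist y z"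
      by (simp add: mult.assoc)
  qed
qed

lemma lip_at_infdist: "lip_at (\<lambda>y. infdist y A) x 1"
  unfolding lip_at_def
proof (intro allI impI exI[of _ 1] conjI ballI)
  fix \<eta> :: real and y z assume "\<eta> > 0"
  have "\<bar>infdist y A - infdist z A\<bar> \<le> 1 * dist y z" using infdist_triangle_abs by simp
  also have "\<dots> \<le> (1 + \<eta>) * dist y z" using \<open>\<eta> > 0\<close> by (intro mult_right_mono) auto
  finally show "\<bar>infdist y A - infdist z A\<bar> \<le> (1 + \<eta>) * dist y z" .
qed simp

lemma lip_at_powr_pos:
  fixes t b :: real
  assumes "t > 0"
  shows "lip_at (\<lambda>s. s powr b) t (\<bar>b\<bar> * t powr (b - 1))"
proof -
  have "lip_at (\<lambda>s. s powr b) t (norm (b * t powr (b - 1)))"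
  \<comment> \<open>On the ball of radius \<open>t\<close> about \<open>t\<close> the base of the
    power stays positive.\<close>
  proof (rule lip_at_C1[where \<rho>=t and g="\<lambda>s. b * s powr (b - 1)"])
    show "isCont (\<lambda>s. b * s powr (b - 1)) t"
      using assms by (intro continuous_intros) auto
    fix s assume "s \<in> ball t t"
    then have "s > 0" by (auto simp: dist_real_def)
    then show "((\<lambda>s. s powr b) has_derivative (\<lambda>h. (b * s powr (b - 1)) \<bullet> h)) (at s)"
      using has_real_derivative_powr[of s b] by (simp add: has_field_derivative_def)
  qed (use assms in auto)
  then show ?thesis by (simp add: abs_mult)
qed

text \<open>The exponents \<open>a\<close> and \<open>1 - a\<close> are such that both terms of the
  product rule depend on \<open>f x\<close> and the distance only through their ratio. With
  \<open>f\<close> a test function and \<open>L\<close> the norm of its gradient, this is the bound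
  in \<open>X\<close> and \<open>Y\<close> announced at the start.\<close>

lemma lip_at_substitution:
  assumes f: "lip_at f x L" and L: "L \<ge> 0" and a: "a > 1" and t: "infdist x A > 0"
  shows "lip_at (\<lambda>y. \<bar>f y\<bar> powr a * infdist y A powr (1 - a)) x
    (a * (\<bar>f x\<bar> / infdist x A) powr (a - 1) * L + (a - 1) * (\<bar>f x\<bar> / infdist x A) powr a)"
proof -
  let ?t = "infdist x A"
  have "lip_at (\<lambda>y. infdist y A powr (1 - a)) x (\<bar>1 - a\<bar> * ?t powr (1 - a - 1) * 1)"
    by (rule lip_at_compose[OF lip_at_infdist lip_at_powr_pos[OF t]]) auto
  then have g: "lip_at (\<lambda>y. infdist y A powr (1 - a)) x ((a - 1) * ?t powr (- a))"
    using a by simp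
  have "lip_at (\<lambda>y. \<bar>f y\<bar> powr a * infdist y A powr (1 - a)) x
    (\<bar>\<bar>f x\<bar> powr a\<bar> * ((a - 1) * ?t powr (- a)) + \<bar>?t powr (1 - a)\<bar> * (a * \<bar>f x\<bar> powr (a - 1) * L))"
    using a L by (intro lip_at_mult[OF lip_at_abs_powr[OF f L a] g]) auto
  moreover have "(\<bar>f x\<bar> / ?t) powr a = \<bar>f x\<bar> powr a * ?t powr (- a)"
    "(\<bar>f x\<bar> / ?t) powr (a - 1) = \<bar>f x\<bar> powr (a - 1) * ?t powr (1 - a)"
    using t powr_minus[of ?t a] powr_minus[of ?t "a - 1"] by (simp_all add: powr_divide field_simps)
  ultimately show ?thesis by (simp add: algebra_simps)
qed

subsection \<open>Hardy's inequality for Lipschitz functions\<close>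

text \<open>A Lebesgue number of the cover by the balls of the pointwise condition gives one radius
  for all of \<open>S\<close>. It supplies a bound for the gradients of all fine mollifications, as
  dominated convergence requires.\<close>

lemma lip_at_uniform:
  fixes v :: "'a::euclidean_space \<Rightarrow> real"
  assumes S: "compact S" and lip: "\<And>x. lip_at v x (G x)" and M: "\<And>x. G x \<le> M"
  obtains r where "r > 0"
    "\<And>x y z. x \<in> S \<Longrightarrow> y \<in> ball x r \<Longrightarrow> z \<in> ball x r \<Longrightarrow> \<bar>v y - v z\<bar> \<le> (M + 1) * dist y z"
proof -
  have "\<exists>r>0. \<forall>y\<in>ball x r. \<forall>z\<in>ball x r. \<bar>v y - v z\<bar> \<le> (G x + 1) * dist y z" for x
    using lip[of x, unfolded lip_at_def, rule_format, OF zero_less_one] .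
  then obtain R where R: "\<And>x. R x > 0"
    "\<And>x y z. y \<in> ball x (R x) \<Longrightarrow> z \<in> ball x (R x) \<Longrightarrow> \<bar>v y - v z\<bar> \<le> (G x + 1) * dist y z"
    by metis
  obtain e where e: "e > 0" "\<And>x. x \<in> S \<Longrightarrow> \<exists>B\<in>(\<lambda>x. ball x (R x)) ` S. ball x e \<subseteq> B"
    by (rule Heine_Borel_lemma[OF S, of "(\<lambda>x. ball x (R x)) ` S"]) (use R(1) that in auto)
  show ?thesis
  proof (rule that[OF e(1)])
    fix x y z assume xyz: "x \<in> S" "y \<in> ball x e" "z \<in> ball x e"
    obtain t where t: "ball x e \<subseteq> ball t (R t)" using e(2)[OF xyz(1)] by blast
    have "\<bar>v y - v z\<bar> \<le> (G t + 1) * dist y z" using t xyz by (intro R(2)) auto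
    also have "\<dots> \<le> (M + 1) * dist y z" using M[of t] by (intro mult_right_mono) auto
    finally show "\<bar>v y - v z\<bar> \<le> (M + 1) * dist y z" .
  qed
qed

text \<open>Leaves room for mollification: smoothing at scale at most \<open>\<delta>\<close>
  spreads a support from \<open>K\<close> no further than \<open>K1\<close>, still inside
  \<open>\<Omega>\<close>.\<close>

lemma compact_enlarge:
  fixes \<Omega> :: "'a::euclidean_space set"
  assumes "compact K" "K \<subseteq> \<Omega>" "open \<Omega>"
  obtains \<delta> K1 where "\<delta> > 0" "compact K1" "K1 \<subseteq> \<Omega>" "K \<subseteq> K1"
    "\<And>x y. x \<in> K \<Longrightarrow> dist y x \<le> \<delta> \<Longrightarrow> y \<in> K1"
proof -
  obtain e where e: "e > 0" "(\<Union>x\<in>K. cball x e) \<subseteq> \<Omega>"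
    by (rule compact_subset_open_imp_cball_epsilon_subset[OF assms(1,3,2)]) (rule that)
  have K1: "(\<Union>x\<in>K. cball x e) = {x + y |x y. x \<in> K \<and> y \<in> cball 0 e}"
  proof safe
    fix x y assume "x \<in> K" "y \<in> cball x e"
    then show "\<exists>x' z. y = x' + z \<and> x' \<in> K \<and> z \<in> cball 0 e"
      by (intro exI[of _ x] exI[of _ "y - x"]) (auto simp: dist_norm norm_minus_commute)
  next
    fix x y assume "x \<in> K" "y \<in> cball (0::'a) e"
    then show "x + y \<in> (\<Union>x\<in>K. cball x e)"
      by (intro UN_I[of x]) (auto simp: dist_norm)
  qed
  have "compact (\<Union>x\<in>K. cball x e)"
    unfolding K1 using assms(1) by (intro compact_sums) auto
  then show ?thesis
    by (rule that[OF e(1) _ e(2)]) (use e(1) in \<open>force simp: dist_commute\<close>)+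
qed

text \<open>
  No weak derivative of the Lipschitz function \<open>v\<close> is needed: the gradients of its mollifications
  are asymptotically bounded by the pointwise Lipschitz constant, so the inequality for test
  functions passes to the limit by dominated convergence.
\<close>

lemma weighted_inequality_Lipschitz:
  fixes v :: "'a::euclidean_space \<Rightarrow> real"
  assumes O: "open \<Omega>" and p: "p > 1"
    and D: "D \<in> borel_measurable borel" "continuous_on \<Omega> D" "\<And>x. x \<in> \<Omega> \<Longrightarrow> D x > 0"
    and test: "\<And>w. w \<in> test_functions \<Omega> \<Longrightarrow>
      H * (\<integral>x. \<bar>w x\<bar> powr p / D x \<partial>lborel) \<le> (\<integral>x. norm (gradient w x) powr p \<partial>lborel)"
    and K: "compact K" "K \<subseteq> \<Omega>" "\<And>x. x \<notin> K \<Longrightarrow> v x = 0" "\<And>x. x \<notin> K \<Longrightarrow> G x = 0"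
    and lip: "\<And>x. lip_at v x (G x)"
    and G: "G \<in> borel_measurable borel" "\<And>x. 0 \<le> G x" "\<And>x. G x \<le> M"
  shows "H * (\<integral>x. \<bar>v x\<bar> powr p / D x \<partial>lborel) \<le> (\<integral>x. G x powr p \<partial>lborel)"
proof -
  obtain \<delta> K1 where K1: "\<delta> > 0" "compact K1" "K1 \<subseteq> \<Omega>" "K \<subseteq> K1"
    "\<And>x y. x \<in> K \<Longrightarrow> dist y x \<le> \<delta> \<Longrightarrow> y \<in> K1"
    by (rule compact_enlarge[OF K(1,2) O]) (rule that)
  obtain r where r: "r > 0"
    "\<And>x y z. x \<in> K1 \<Longrightarrow> y \<in> ball x r \<Longrightarrow> z \<in> ball x r \<Longrightarrow> \<bar>v y - v z\<bar> \<le> (M + 1) * dist y z"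
    by (rule lip_at_uniform[OF K1(2) lip G(3)]) (rule that)
  have M: "M \<ge> 0" using G(2,3) order_trans by blast
  have cv: "continuous_on UNIV v"
    using lip_at_isCont[OF lip] by (intro continuous_at_imp_continuous_on) auto
  obtain B where B: "B > 0" "\<And>x. \<bar>v x\<bar> \<le> B"
    by (rule bounded_compact_support[of K v])
       (use K(1,3) cv that in \<open>auto intro: continuous_on_subset\<close>)
  \<comment> \<open>At most half of \<open>min \<delta> r\<close>: the mollifications are then
    supported in \<open>K1\<close>, and the balls of radius \<open>\<epsilon> n + r / 2\<close> stay
    within the uniform radius \<open>r\<close>.\<close>
  define \<epsilon> where "\<epsilon> n = min \<delta> r / (2 * real (Suc n))" for n
  have e: "\<epsilon> n > 0" "\<epsilon> n \<le> \<delta>" "\<epsilon> n + r / 2 \<le> r" for n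
  proof -
    have "\<epsilon> n \<le> min \<delta> r / 2"
      unfolding \<epsilon>_def using K1(1) r(1) by (intro divide_left_mono) auto
    then show "\<epsilon> n \<le> \<delta>" "\<epsilon> n + r / 2 \<le> r"
      using K1(1) r(1) by linarith+
    show "\<epsilon> n > 0" using K1(1) r(1) by (simp add: \<epsilon>_def)
  qed
  have elim: "\<epsilon> \<longlonglongrightarrow> 0"
  proof -
    have "(\<lambda>n. (min \<delta> r / 2) * inverse (real (Suc n))) \<longlonglongrightarrow> 0"
      using LIMSEQ_inverse_real_of_nat by (rule tendsto_mult_right_zero)
    then show ?thesis by (simp add: \<epsilon>_def[abs_def] field_simps)
  qed
  \<comment> \<open>The properties of a mollification are put into object-level quantifiers so that
    one \<open>w\<close> can be chosen for each \<open>n\<close>.\<close>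
  have "\<exists>w. (\<forall>k. C_k k w) \<and>
    (\<forall>x c \<eta>. (\<forall>y. dist y x \<le> \<epsilon> n \<longrightarrow> \<bar>v y - c\<bar> \<le> \<eta>) \<longrightarrow> \<bar>w x - c\<bar> \<le> \<eta>) \<and>
    (\<forall>x L r. r > 0 \<longrightarrow> L \<ge> 0 \<longrightarrow> (\<forall>y\<in>ball x (\<epsilon> n + r). \<forall>z\<in>ball x (\<epsilon> n + r). \<bar>v y - v z\<bar> \<le> L * dist y z) \<longrightarrow>
      norm (gradient w x) \<le> L)" for n
  proof (rule mollification[OF K(1) cv _ e(1)[of n]])
    fix w assume w: "\<And>k. C_k k w"
      "\<And>x c \<eta>. (\<And>y. dist y x \<le> \<epsilon> n \<Longrightarrow> \<bar>v y - c\<bar> \<le> \<eta>) \<Longrightarrow> \<bar>w x - c\<bar> \<le> \<eta>"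
      "\<And>x L r. r > 0 \<Longrightarrow> L \<ge> 0 \<Longrightarrow>
        (\<And>y z. y \<in> ball x (\<epsilon> n + r) \<Longrightarrow> z \<in> ball x (\<epsilon> n + r) \<Longrightarrow> \<bar>v y - v z\<bar> \<le> L * dist y z) \<Longrightarrow>
        norm (gradient w x) \<le> L"
    show ?thesis
    proof (intro exI[of _ w] conjI allI impI w(1))
      show "\<bar>w x - c\<bar> \<le> \<eta>" if "\<forall>y. dist y x \<le> \<epsilon> n \<longrightarrow> \<bar>v y - c\<bar> \<le> \<eta>" for x c \<eta>
        by (rule w(2)) (use that in blast)
      show "norm (gradient w x) \<le> L" if "r > 0" "L \<ge> 0"
        "\<forall>y\<in>ball x (\<epsilon> n + r). \<forall>z\<in>ball x (\<epsilon> n + r). \<bar>v y - v z\<bar> \<le> L * dist y z" for x L r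
        by (rule w(3)[OF that(1,2)]) (use that(3) in blast)
    qed
  qed (rule K(3))
  then obtain w where w: "\<And>n k. C_k k (w n)"
    and wc: "\<And>n x c \<eta>. \<forall>y. dist y x \<le> \<epsilon> n \<longrightarrow> \<bar>v y - c\<bar> \<le> \<eta> \<Longrightarrow> \<bar>w n x - c\<bar> \<le> \<eta>"
    and wg: "\<And>n x L r. r > 0 \<Longrightarrow> L \<ge> 0 \<Longrightarrow>
      \<forall>y\<in>ball x (\<epsilon> n + r). \<forall>z\<in>ball x (\<epsilon> n + r). \<bar>v y - v z\<bar> \<le> L * dist y z \<Longrightarrow>
      norm (gradient (w n) x) \<le> L"
    by metis
  have w0: "w n x = 0" if "x \<notin> K1" for n x
  proof -
    have "y \<notin> K" if "dist y x \<le> \<epsilon> n" for y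
      using K1(5)[of y x] e(2)[of n] that \<open>x \<notin> K1\<close> by (auto simp: dist_commute)
    then have "\<bar>w n x - 0\<bar> \<le> 0" using K(3) by (intro wc) auto
    then show ?thesis by simp
  qed
  have g0: "gradient (w n) x = 0" if "x \<notin> K1" for n x
    using gradient_eq_0_outside[OF compact_imp_closed[OF K1(2)] w0 that] .
  have cw: "continuous_on UNIV (w n)" for n using C_k_imp_continuous[OF w] .
  have cg: "continuous_on UNIV (gradient (w n))" for n using continuous_gradient[OF w] .
  have test_w: "w n \<in> test_functions \<Omega>" for n
    by (rule test_functionsI[OF w K1(2,3) w0])
  have wB: "\<bar>w n x\<bar> \<le> B" for n x
    using wc[of x n 0 B] B(2) by simp
  have gM: "norm (gradient (w n) x) \<le> M + 1" for n x
  proof (cases "x \<in> K1")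
    case True
    have "ball x (\<epsilon> n + r / 2) \<subseteq> ball x r" using e(3)[of n] by auto
    then have "\<forall>y\<in>ball x (\<epsilon> n + r / 2). \<forall>z\<in>ball x (\<epsilon> n + r / 2). \<bar>v y - v z\<bar> \<le> (M + 1) * dist y z"
      using r(2)[OF True] by blast
    then show ?thesis using r(1) M by (intro wg[of "r / 2"]) auto
  qed (use g0 M in simp)
  have wlim: "(\<lambda>n. w n x) \<longlonglongrightarrow> v x" for x
  proof (rule LIMSEQ_I)
    fix \<eta> :: real assume "\<eta> > 0"
    then obtain d where d: "d > 0" "\<And>y. dist y x < d \<Longrightarrow> \<bar>v y - v x\<bar> < \<eta> / 2"
      using lip_at_isCont[OF lip, of x] unfolding continuous_at_eps_delta
      by (metis dist_real_def half_gt_zero)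
    obtain N where N: "\<And>n. n \<ge> N \<Longrightarrow> \<epsilon> n < d"
      using order_tendstoD(2)[OF elim d(1)] by (auto simp: eventually_sequentially)
    show "\<exists>N. \<forall>n\<ge>N. norm (w n x - v x) < \<eta>"
    proof (intro exI[of _ N] allI impI)
      fix n assume "n \<ge> N"
      then have "\<bar>w n x - v x\<bar> \<le> \<eta> / 2"
        using N[of n] d(2) by (intro wc allI impI less_imp_le) auto
      then show "norm (w n x - v x) < \<eta>" using \<open>\<eta> > 0\<close> by simp
    qed
  qed
  \<comment> \<open>The gradients of the mollifications need not converge; only their upper limit is
    at most \<open>G x\<close>. Taking the maximum with \<open>G x\<close> produces a convergent
    sequence that still dominates them.\<close>
  have glim: "(\<lambda>n. max (norm (gradient (w n) x)) (G x)) \<longlonglongrightarrow> G x" for x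
  proof (rule LIMSEQ_I)
    fix \<eta> :: real assume \<eta>: "\<eta> > 0"
    obtain d where d: "d > 0"
      "\<And>y z. y \<in> ball x d \<Longrightarrow> z \<in> ball x d \<Longrightarrow> \<bar>v y - v z\<bar> \<le> (G x + \<eta> / 2) * dist y z"
      by (rule lip_atD[OF lip, of "\<eta> / 2" x]) (use \<eta> that in auto)
    obtain N where N: "\<And>n. n \<ge> N \<Longrightarrow> \<epsilon> n < d / 2"
      using order_tendstoD(2)[OF elim, of "d / 2"] d(1) by (auto simp: eventually_sequentially)
    show "\<exists>N. \<forall>n\<ge>N. norm (max (norm (gradient (w n) x)) (G x) - G x) < \<eta>"
    proof (intro exI[of _ N] allI impI)
      fix n assume "n \<ge> N"
      then have "ball x (\<epsilon> n + d / 2) \<subseteq> ball x d" using N[of n] by auto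
      then have "\<forall>y\<in>ball x (\<epsilon> n + d / 2). \<forall>z\<in>ball x (\<epsilon> n + d / 2). \<bar>v y - v z\<bar> \<le> (G x + \<eta> / 2) * dist y z"
        using d(2) by blast
      then have "norm (gradient (w n) x) \<le> G x + \<eta> / 2"
        using d G(2)[of x] \<eta> by (intro wg[of "d / 2"]) auto
      then show "norm (max (norm (gradient (w n) x)) (G x) - G x) < \<eta>" using \<eta> by auto
    qed
  qed
  have mv: "v \<in> borel_measurable borel" using cv by (rule borel_measurable_continuous_onI)
  have mw: "w n \<in> borel_measurable borel" for n using cw by (rule borel_measurable_continuous_onI)
  have mg: "gradient (w n) \<in> borel_measurable borel" for n
    using cg by (rule borel_measurable_continuous_onI)
  obtain C where C: "\<And>x. x \<in> K1 \<Longrightarrow> 1 / D x \<le> C"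
  proof -
    have "continuous_on K1 (\<lambda>x. 1 / D x)"
      using D(2,3) K1(3) by (intro continuous_intros continuous_on_subset[OF D(2)]) (auto simp: subset_iff less_imp_neq[symmetric])
    then have "bounded ((\<lambda>x. 1 / D x) ` K1)"
      using K1(2) compact_continuous_image compact_imp_bounded by blast
    then obtain C where "\<forall>x\<in>K1. \<bar>1 / D x\<bar> \<le> C" unfolding bounded_iff by auto
    then show ?thesis by (meson abs_le_D1 that)
  qed
  have "(\<lambda>n. \<integral>x. \<bar>w n x\<bar> powr p / D x \<partial>lborel) \<longlonglongrightarrow> (\<integral>x. \<bar>v x\<bar> powr p / D x \<partial>lborel)"
  proof (rule integral_dominated_convergence)
    show "integrable lborel (\<lambda>x. if x \<in> K1 then B powr p * C else 0)"
      by (rule integrable_const_compact[OF K1(2)])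
    show "(\<lambda>x. \<bar>v x\<bar> powr p / D x) \<in> borel_measurable lborel" using mv D(1) by measurable
    show "(\<lambda>x. \<bar>w n x\<bar> powr p / D x) \<in> borel_measurable lborel" for n using mw[of n] D(1) by measurable
    have "(\<lambda>n. \<bar>w n x\<bar> powr p) \<longlonglongrightarrow> \<bar>v x\<bar> powr p" for x
      using p by (intro tendsto_powr' tendsto_intros wlim) auto
    from tendsto_mult_right[OF this, of _ "1 / D x" for x]
    show "AE x in lborel. (\<lambda>n. \<bar>w n x\<bar> powr p / D x) \<longlonglongrightarrow> \<bar>v x\<bar> powr p / D x"
      by (intro AE_I2) simp
    have "norm (\<bar>w n x\<bar> powr p / D x) \<le> (if x \<in> K1 then B powr p * C else 0)" for n x
    proof (cases "x \<in> K1")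
      case True
      then have "D x > 0" using D(3) K1(3) by auto
      moreover have "\<bar>w n x\<bar> powr p * (1 / D x) \<le> B powr p * C"
        using wB[of n x] C[OF True] p \<open>D x > 0\<close> by (intro mult_mono powr_mono2) auto
      ultimately show ?thesis using True by simp
    qed (use w0 p in simp)
    then show "AE x in lborel. norm (\<bar>w n x\<bar> powr p / D x) \<le> (if x \<in> K1 then B powr p * C else 0)" for n
      by simp
  qed
  then have L: "(\<lambda>n. H * (\<integral>x. \<bar>w n x\<bar> powr p / D x \<partial>lborel)) \<longlonglongrightarrow> H * (\<integral>x. \<bar>v x\<bar> powr p / D x \<partial>lborel)"
    by (rule tendsto_mult_left)
  let ?g = "\<lambda>n x. max (norm (gradient (w n) x)) (G x) powr p"
  have dom: "norm (?g n x) \<le> (if x \<in> K1 then (M + 1) powr p else 0)" for n x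
  proof (cases "x \<in> K1")
    case True
    have "?g n x \<le> (M + 1) powr p"
      using p gM[of n x] G(3)[of x] G(2)[of x] by (intro powr_mono2) (auto simp: max_def)
    then show ?thesis using True by simp
  next
    case False
    then have "G x = 0" using K(4) K1(4) by blast
    then show ?thesis using False g0 p by simp
  qed
  have i1: "integrable lborel (\<lambda>x. if x \<in> K1 then (M + 1) powr p else 0)"
    by (rule integrable_const_compact[OF K1(2)])
  have mgx: "?g n \<in> borel_measurable lborel" for n using mg[of n] G(1) by measurable
  have R: "(\<lambda>n. \<integral>x. ?g n x \<partial>lborel) \<longlonglongrightarrow> (\<integral>x. G x powr p \<partial>lborel)"
  proof (rule integral_dominated_convergence[OF _ mgx i1])
    show "(\<lambda>x. G x powr p) \<in> borel_measurable lborel" using G(1) by measurable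
    have "(\<lambda>n. ?g n x) \<longlonglongrightarrow> G x powr p" for x
      using p G(2)[of x] by (intro tendsto_powr' tendsto_intros glim) (auto simp: le_max_iff_disj)
    then show "AE x in lborel. (\<lambda>n. ?g n x) \<longlonglongrightarrow> G x powr p" by simp
  qed (use dom in simp)
  have ig: "integrable lborel (?g n)" for n
    by (rule Bochner_Integration.integrable_bound[OF i1 mgx]) (use dom in \<open>auto intro!: AE_I2\<close>)
  have "H * (\<integral>x. \<bar>w n x\<bar> powr p / D x \<partial>lborel) \<le> (\<integral>x. ?g n x \<partial>lborel)" for n
  proof -
    have "integrable lborel (\<lambda>x. norm (gradient (w n) x) powr p)"
      by (rule Bochner_Integration.integrable_bound[OF ig[of n]])
         (use mg[of n] p in \<open>auto intro!: AE_I2 powr_mono2\<close>)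
    then have "(\<integral>x. norm (gradient (w n) x) powr p \<partial>lborel) \<le> (\<integral>x. ?g n x \<partial>lborel)"
      using ig[of n] p by (intro integral_mono) (auto intro!: powr_mono2)
    with test[OF test_w[of n]] show ?thesis by linarith
  qed
  then show ?thesis using LIMSEQ_le[OF L R] by blast
qed

section \<open>The pointwise inequality behind the change of exponent\<close>

lemma powr_convex_combination:
  fixes p x y l :: real
  assumes "p \<ge> 1" "x \<ge> 0" "y \<ge> 0" "0 \<le> l" "l \<le> 1"
  shows "(l * x + (1 - l) * y) powr p \<le> l * x powr p + (1 - l) * y powr p"
proof -
  \<comment> \<open>Handles a vanishing \<open>x\<close> or \<open>y\<close>, where the claim
    reduces to comparing a weight with its \<open>p\<close>-th power. Otherwise convexity on the
    positive reals applies.\<close>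
  have s: "s powr p \<le> s" if "0 \<le> s" "s \<le> 1" for s :: real
    using powr_mono'[of 1 p s] that assms(1) by simp
  consider "x = 0" | "y = 0" | "x > 0" "y > 0" using assms by linarith
  then show ?thesis
  proof cases
    case 1
    then show ?thesis using s[of "1 - l"] assms by (simp add: powr_mult mult_right_mono)
  next
    case 2
    then show ?thesis using s[of l] assms by (simp add: powr_mult mult_right_mono)
  next
    case 3
    then show ?thesis
      using convex_onD[OF powr_convex[OF assms(1)], of "1 - l" x y] assms by simp
  qed
qed

text \<open>
  A pointwise substitute for the Hoelder and Minkowski inequalities. With \<open>a = q / p\<close> and
  \<open>h = a * \<theta> + a - 1\<close>, the left-hand base is \<open>h * X\<^sup>a\<^sup>-\<^sup>1\<close> times the convex combination of
  \<open>Y / \<theta>\<close> and \<open>X\<close> with weight \<open>l = a * \<theta> / h\<close>; convexity and Young's inequality do the rest.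
\<close>

lemma pointwise_bound:
  fixes p q \<theta> X Y :: real
  assumes p: "p > 1" and q: "q > p" and \<theta>: "\<theta> > 0" and X: "X \<ge> 0" and Y: "Y \<ge> 0"
  defines "a \<equiv> q / p"
  defines "h \<equiv> a * \<theta> + a - 1"
  defines "l \<equiv> a * \<theta> / h"
  shows "(a * X powr (a - 1) * Y + (a - 1) * X powr a) powr p
    \<le> h powr p * ((1 - l * (p / q)) * X powr q + l * (p / q) * (Y powr q / \<theta> powr q))"
proof (cases "X = 0")
  case True
  have a: "a > 1" using p q by (simp add: a_def)
  have h: "h > 0" using a \<theta> by (smt (verit) h_def mult_pos_pos)
  then show ?thesis using True a p q \<theta> Y by (simp add: l_def)
next
  case False
  with X have X: "X > 0" by simp
  have a: "a > 1" using p q by (simp add: a_def)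
  have h: "h > 0" using a \<theta> by (smt (verit) h_def mult_pos_pos)
  have l: "0 \<le> l" "l \<le> 1" and lh: "l * h = a * \<theta>" "(1 - l) * h = a - 1"
    using h a \<theta> by (auto simp: l_def h_def field_simps)
  define Z where "Z = Y / \<theta>"
  have Z: "Z \<ge> 0" using Y \<theta> by (simp add: Z_def)
  have "X powr a = X powr (a - 1) * X" using X by (simp add: powr_diff)
  then have "a * X powr (a - 1) * Y + (a - 1) * X powr a = X powr (a - 1) * (a * Y + (a - 1) * X)"
    by (simp add: algebra_simps)
  also have "a * Y + (a - 1) * X = h * (l * Z + (1 - l) * X)"
    using lh \<theta> by (simp add: Z_def distrib_left mult.assoc[symmetric] mult.commute[of h])
  finally have "(a * X powr (a - 1) * Y + (a - 1) * X powr a) powr p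
      = (X powr (a - 1)) powr p * h powr p * (l * Z + (1 - l) * X) powr p"
    using X h l Z by (simp add: powr_mult mult.assoc)
  also have "(X powr (a - 1)) powr p = X powr (q - p)"
    using p by (simp add: powr_powr a_def left_diff_distrib)
  also have "X powr (q - p) * h powr p * (l * Z + (1 - l) * X) powr p
      \<le> X powr (q - p) * h powr p * (l * Z powr p + (1 - l) * X powr p)"
    using p X Z l by (intro mult_left_mono powr_convex_combination) auto
  also have "\<dots> = h powr p * (l * (X powr (q - p) * Z powr p) + (1 - l) * (X powr (q - p) * X powr p))"
    by (simp add: algebra_simps)
  also have "X powr (q - p) * X powr p = X powr q"
    by (simp add: powr_add[symmetric])
  \<comment> \<open>Young's inequality with weights \<open>1 - p / q\<close> and
    \<open>p / q\<close> splits the mixed product into pure \<open>q\<close>-th powers, which are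
    the integrands of the Hardy inequality with exponent \<open>q\<close>.\<close>
  also have "X powr (q - p) * Z powr p \<le> (1 - p / q) * X powr q + p / q * Z powr q"
  proof (cases "Z = 0")
    case True
    then show ?thesis using p q by simp
  next
    case False
    have "(X powr q) powr (1 - p / q) * (Z powr q) powr (p / q) \<le> (1 - p / q) * X powr q + p / q * Z powr q"
      using p q X Z False by (intro Youngs_inequality_0) auto
    moreover have "q * (1 - p / q) = q - p" using p q by (simp add: field_simps)
    ultimately show ?thesis using p q by (simp add: powr_powr)
  qed
  also have "h powr p * (l * ((1 - p / q) * X powr q + p / q * Z powr q) + (1 - l) * X powr q)
     = h powr p * ((1 - l * (p / q)) * X powr q + l * (p / q) * Z powr q)"
    by (simp add: algebra_simps)
  also have "Z powr q = Y powr q / \<theta> powr q"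
    using Y \<theta> by (simp add: Z_def powr_divide)
  finally show ?thesis using l by (simp add: mult_left_mono)
qed

subsection \<open>Passing to the closure of the test functions\<close>

text \<open>Fatou's lemma delivers integrability of the limit along with the bound. The former
  matters by itself, since a Hardy quotient with a nonintegrable denominator counts as 0.\<close>

lemma integral_le_of_AE_limit:
  fixes f :: "'a \<Rightarrow> real"
  assumes fn: "\<And>n. integrable M (f' n)" "\<And>n x. 0 \<le> f' n x"
    and f: "f \<in> borel_measurable M" "\<And>x. 0 \<le> f x"
    and lim: "AE x in M. (\<lambda>n. f' n x) \<longlonglongrightarrow> f x"
    and b: "\<And>n. integral\<^sup>L M (f' n) \<le> b' n" "b' \<longlonglongrightarrow> b"
  shows "integrable M f" "integral\<^sup>L M f \<le> b"
proof -
  have "(\<integral>\<^sup>+x. f x \<partial>M) = (\<integral>\<^sup>+x. liminf (\<lambda>n. ennreal (f' n x)) \<partial>M)"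
  proof (rule nn_integral_cong_AE)
    show "AE x in M. ennreal (f x) = liminf (\<lambda>n. ennreal (f' n x))"
      using lim
    proof eventually_elim
      case (elim x)
      then show ?case using lim_imp_Liminf[OF _ tendsto_ennrealI[OF elim]] by simp
    qed
  qed
  also have "\<dots> \<le> liminf (\<lambda>n. \<integral>\<^sup>+x. f' n x \<partial>M)"
    using fn by (intro nn_integral_liminf) auto
  also have "\<dots> \<le> liminf (\<lambda>n. ennreal (b' n))"
    using fn b(1) by (intro Liminf_mono always_eventually allI)
      (simp add: nn_integral_eq_integral ennreal_leI)
  also have "\<dots> = ennreal b"
    using lim_imp_Liminf[OF _ tendsto_ennrealI[OF b(2)]] by simp
  finally have le: "(\<integral>\<^sup>+x. f x \<partial>M) \<le> ennreal b" .
  then show i: "integrable M f"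
    using f by (intro integrableI_nonneg) (auto simp: less_top[symmetric] top_unique)
  have "0 \<le> b' n" for n using b(1)[of n] fn by (meson Bochner_Integration.integral_nonneg order_trans)
  then have "0 \<le> b" using LIMSEQ_le_const[OF b(2)] by blast
  then show "integral\<^sup>L M f \<le> b"
    using le i f by (simp add: nn_integral_eq_integral)
qed

text \<open>Convexity applied to \<open>norm x / (1 - t)\<close> and \<open>norm y / t\<close> with
  weights \<open>1 - t\<close> and \<open>t\<close>. It replaces Minkowski's inequality: for small
  \<open>t\<close> the factor of the main term \<open>x\<close> is close to 1, and the large factor
  of \<open>y\<close> is harmless when \<open>y\<close> is an error tending to 0.\<close>

lemma norm_add_powr_le:
  fixes x y :: "'b::real_normed_vector"
  assumes p: "p \<ge> 1" and t: "0 < t" "t < 1"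
  shows "norm (x + y) powr p \<le> (1 - t) powr (1 - p) * norm x powr p + t powr (1 - p) * norm y powr p"
proof -
  have "norm (x + y) powr p \<le> ((1 - t) * (norm x / (1 - t)) + (1 - (1 - t)) * (norm y / t)) powr p"
    using p t norm_triangle_ineq[of x y] by (intro powr_mono2) auto
  also have "\<dots> \<le> (1 - t) * (norm x / (1 - t)) powr p + (1 - (1 - t)) * (norm y / t) powr p"
    using p t by (intro powr_convex_combination) auto
  also have "\<dots> = (1 - t) powr (1 - p) * norm x powr p + t powr (1 - p) * norm y powr p"
    using t by (simp add: powr_divide powr_diff)
  finally show ?thesis .
qed

lemma integrable_powr_norm_diff:
  fixes f g :: "'a \<Rightarrow> 'b::euclidean_space"
  assumes p: "p \<ge> 1" and "f \<in> borel_measurable M" "g \<in> borel_measurable M"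
    and "integrable M (\<lambda>x. norm (f x) powr p)" "integrable M (\<lambda>x. norm (g x) powr p)"
  shows "integrable M (\<lambda>x. norm (f x - g x) powr p)"
proof (rule Bochner_Integration.integrable_bound)
  let ?c = "(1 / 2 :: real) powr (1 - p)"
  show "integrable M (\<lambda>x. ?c * norm (f x) powr p + ?c * norm (g x) powr p)"
    using assms by simp
  show "(\<lambda>x. norm (f x - g x) powr p) \<in> borel_measurable M"
    using assms by measurable
  show "AE x in M. norm (norm (f x - g x) powr p) \<le> norm (?c * norm (f x) powr p + ?c * norm (g x) powr p)"
    using norm_add_powr_le[OF p, of "1 / 2" "f x" "- g x" for x] by (intro AE_I2) simp
qed

text \<open>An open set with empty frontier is also closed, hence empty or the whole space.
  Nonemptiness of the frontier has to be secured because \<open>infdist\<close> from the empty set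
  is 0 by convention.\<close>

lemma bdist_pos:
  fixes \<Omega> :: "'a::euclidean_space set"
  assumes "open \<Omega>" "\<Omega> \<noteq> UNIV" "x \<in> \<Omega>"
  shows "bdist \<Omega> x > 0"
  unfolding bdist_def
proof (rule infdist_pos_not_in_closed)
  show "frontier \<Omega> \<noteq> {}"
  proof
    assume "frontier \<Omega> = {}"
    then have "closed \<Omega>" using assms(1) by (simp add: frontier_subset_eq[symmetric])
    then show False using assms clopen[of \<Omega>] by auto
  qed
  show "x \<notin> frontier \<Omega>" using assms by (simp add: frontier_def interior_open)
qed simp

lemma continuous_bdist: "continuous_on S (bdist \<Omega>)"
  unfolding bdist_def[abs_def] by (intro continuous_intros)

lemma borel_measurable_bdist [measurable]: "bdist \<Omega> \<in> borel_measurable borel"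
  using continuous_bdist by (rule borel_measurable_continuous_onI)

lemma test_function_integrals:
  fixes \<Omega> :: "'a::euclidean_space set"
  assumes O: "open \<Omega>" "\<Omega> \<noteq> UNIV" and \<phi>: "\<phi> \<in> test_functions \<Omega>" and q: "q > 0"
  shows "integrable lborel (\<lambda>x. \<bar>\<phi> x\<bar> powr q / bdist \<Omega> x powr q)"
    and "integrable (lebesgue_on \<Omega>) (\<lambda>x. \<bar>\<phi> x\<bar> powr q / bdist \<Omega> x powr q)"
    and "(LINT x|lebesgue_on \<Omega>. \<bar>\<phi> x\<bar> powr q / bdist \<Omega> x powr q) =
      (\<integral>x. \<bar>\<phi> x\<bar> powr q / bdist \<Omega> x powr q \<partial>lborel)"
    and "integrable lborel (\<lambda>x. norm (gradient \<phi> x) powr q)"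
    and "(LINT x|lebesgue_on \<Omega>. norm (gradient \<phi> x) powr q) =
      (\<integral>x. norm (gradient \<phi> x) powr q \<partial>lborel)"
proof -
  obtain K where K: "compact K" "K \<subseteq> \<Omega>" "\<And>x. x \<notin> K \<Longrightarrow> \<phi> x = 0" "\<And>x. x \<notin> K \<Longrightarrow> gradient \<phi> x = 0"
    "continuous_on UNIV \<phi>" "continuous_on UNIV (gradient \<phi>)"
    using \<phi> by (rule test_functionsE) (rule that)
  have pos: "bdist \<Omega> x > 0" if "x \<in> K" for x using bdist_pos[OF O] K(2) that by blast
  have z: "\<phi> x = 0" "gradient \<phi> x = 0" if "x \<notin> \<Omega>" for x using that K(2,3,4) by auto
  have c1: "continuous_on K (\<lambda>x. \<bar>\<phi> x\<bar> powr q)"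
    using q K(5) by (intro continuous_on_powr') (auto intro!: continuous_intros intro: continuous_on_subset)
  have c2: "continuous_on K (\<lambda>x. bdist \<Omega> x powr q)"
    using pos by (intro continuous_on_powr continuous_bdist) (auto intro!: continuous_intros simp: less_imp_neq[symmetric])
  have c3: "continuous_on K (\<lambda>x. norm (gradient \<phi> x) powr q)"
    using q K(6) by (intro continuous_on_powr') (auto intro!: continuous_intros intro: continuous_on_subset)
  show i: "integrable lborel (\<lambda>x. \<bar>\<phi> x\<bar> powr q / bdist \<Omega> x powr q)"
    by (rule integrable_compact_support[OF K(1) continuous_on_divide[OF c1 c2]])
       (use pos K(3) in \<open>auto simp: less_imp_neq[symmetric]\<close>)
  show j: "integrable lborel (\<lambda>x. norm (gradient \<phi> x) powr q)"
    by (rule integrable_compact_support[OF K(1) c3]) (use K(4) in auto)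
  show "integrable (lebesgue_on \<Omega>) (\<lambda>x. \<bar>\<phi> x\<bar> powr q / bdist \<Omega> x powr q)"
    "(LINT x|lebesgue_on \<Omega>. \<bar>\<phi> x\<bar> powr q / bdist \<Omega> x powr q) =
      (\<integral>x. \<bar>\<phi> x\<bar> powr q / bdist \<Omega> x powr q \<partial>lborel)"
    using z O by (auto intro!: integrable_lebesgue_on_support i)
  show "(LINT x|lebesgue_on \<Omega>. norm (gradient \<phi> x) powr q) =
      (\<integral>x. norm (gradient \<phi> x) powr q \<partial>lborel)"
    using z O by (auto intro!: integrable_lebesgue_on_support j)
qed

text \<open>Approximating test functions converge almost everywhere along a subsequence, so Fatou's
  lemma handles the side with the distance. On the gradient side convergence in L^q is used.
  Dividing by \<open>c > 0\<close> turns the bound on gradients into the bound that yields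
  integrability.\<close>

lemma hardy_inequality_sobolev0:
  fixes \<Omega> :: "'a::euclidean_space set"
  assumes O: "open \<Omega>" "\<Omega> \<noteq> UNIV" and q: "q > 1" and c: "c > 0"
    and test: "\<And>\<phi>. \<phi> \<in> test_functions \<Omega> \<Longrightarrow>
      c * (\<integral>x. \<bar>\<phi> x\<bar> powr q / bdist \<Omega> x powr q \<partial>lborel) \<le> (\<integral>x. norm (gradient \<phi> x) powr q \<partial>lborel)"
    and ug: "(u, g) \<in> sobolev0 \<Omega> q"
  shows "integrable (lebesgue_on \<Omega>) (\<lambda>x. \<bar>u x\<bar> powr q / bdist \<Omega> x powr q)"
    and "c * (LINT x|lebesgue_on \<Omega>. \<bar>u x\<bar> powr q / bdist \<Omega> x powr q)
      \<le> (LINT x|lebesgue_on \<Omega>. norm (g x) powr q)"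
proof -
  let ?M = "lebesgue_on \<Omega>"
  have u: "u \<in> borel_measurable ?M" "integrable ?M (\<lambda>x. norm (u x) powr q)"
    and g: "g \<in> borel_measurable ?M" "integrable ?M (\<lambda>x. norm (g x) powr q)"
    using ug by (auto simp: sobolev0_def sobolev_def in_Lp_def)
  have Lp: "in_Lp \<Omega> q \<phi>" "in_Lp \<Omega> q (gradient \<phi>)" if "\<phi> \<in> test_functions \<Omega>" for \<phi>
    using test_functions_in_sobolev0[OF O(1) that, of q] q by (auto simp: sobolev0_def sobolev_def)
  have ex: "\<exists>\<phi>\<in>test_functions \<Omega>. (LINT x|?M. norm (u x - \<phi> x) powr q) \<le> inverse (real (Suc n)) \<and>
      (LINT x|?M. norm (g x - gradient \<phi> x) powr q) \<le> inverse (real (Suc n))" for n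
  proof -
    let ?e = "inverse (real (Suc n))"
    \<comment> \<open>\<open>sobolev_norm\<close> is a \<open>q\<close>-th root, so this tolerance
      makes the sum of the two integrals less than \<open>?e\<close>.\<close>
    have "?e powr (1 / q) > 0" by simp
    then obtain \<phi> where \<phi>: "\<phi> \<in> test_functions \<Omega>"
      "sobolev_norm \<Omega> q (\<lambda>x. u x - \<phi> x) (\<lambda>x. g x - gradient \<phi> x) < ?e powr (1 / q)"
      using ug unfolding sobolev0_def by blast
    let ?A = "LINT x|?M. norm (u x - \<phi> x) powr q" and ?B = "LINT x|?M. norm (g x - gradient \<phi> x) powr q"
    have "(?A + ?B) powr (1 / q) < ?e powr (1 / q)"
      using \<phi>(2) by (simp add: sobolev_norm_def)
    then have "?A + ?B < ?e"
      using q powr_mono2[of "1 / q" ?e "?A + ?B"] by (rule_tac ccontr) auto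
    moreover have "?A \<ge> 0" "?B \<ge> 0" by simp_all
    ultimately have "?A \<le> ?e" "?B \<le> ?e" by linarith+
    then show ?thesis using \<phi>(1) by (intro bexI[of _ \<phi>] conjI)
  qed
  have "\<exists>\<phi>. \<forall>n. \<phi> n \<in> test_functions \<Omega> \<and>
      (LINT x|?M. norm (u x - \<phi> n x) powr q) \<le> inverse (real (Suc n)) \<and>
      (LINT x|?M. norm (g x - gradient (\<phi> n) x) powr q) \<le> inverse (real (Suc n))"
    by (intro choice allI ex[unfolded Bex_def])
  then obtain \<phi> where *: "\<forall>n. \<phi> n \<in> test_functions \<Omega> \<and>
      (LINT x|?M. norm (u x - \<phi> n x) powr q) \<le> inverse (real (Suc n)) \<and>
      (LINT x|?M. norm (g x - gradient (\<phi> n) x) powr q) \<le> inverse (real (Suc n))"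
    by (rule exE)
  note \<phi> = *[rule_format, THEN conjunct1]
    and A = *[rule_format, THEN conjunct2, THEN conjunct1]
    and B = *[rule_format, THEN conjunct2, THEN conjunct2]
  have m: "\<phi> n \<in> borel_measurable ?M" "gradient (\<phi> n) \<in> borel_measurable ?M"
    "integrable ?M (\<lambda>x. norm (\<phi> n x) powr q)" "integrable ?M (\<lambda>x. norm (gradient (\<phi> n) x) powr q)" for n
    using Lp[OF \<phi>] by (auto simp: in_Lp_def)
  have iA: "integrable ?M (\<lambda>x. norm (u x - \<phi> n x) powr q)" for n
    using q by (intro integrable_powr_norm_diff u m) auto
  have iB: "integrable ?M (\<lambda>x. norm (g x - gradient (\<phi> n) x) powr q)" for n
    using q by (intro integrable_powr_norm_diff g m) auto
  have "(\<lambda>n. LINT x|?M. norm (norm (u x - \<phi> n x) powr q)) \<longlonglongrightarrow> 0"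
    by (rule tendsto_sandwich[OF _ _ tendsto_const LIMSEQ_inverse_real_of_nat]) (use A in auto)
  from tendsto_L1_AE_subseq[OF iA this] obtain r where r: "strict_mono r"
    and lim: "AE x in ?M. (\<lambda>n. norm (u x - \<phi> (r n) x) powr q) \<longlonglongrightarrow> 0" by blast
  have lim': "AE x in ?M. (\<lambda>n. \<bar>\<phi> (r n) x\<bar> powr q / bdist \<Omega> x powr q) \<longlonglongrightarrow> \<bar>u x\<bar> powr q / bdist \<Omega> x powr q"
    using lim AE_space
  proof eventually_elim
    case (elim x)
    have "(\<lambda>n. (norm (u x - \<phi> (r n) x) powr q) powr (1 / q)) \<longlonglongrightarrow> 0 powr (1 / q)"
      using q elim(1) by (intro tendsto_powr' tendsto_const) auto
    then have "(\<lambda>n. norm (u x - \<phi> (r n) x)) \<longlonglongrightarrow> 0"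
      using q by (simp add: powr_powr)
    then have "(\<lambda>n. u x - \<phi> (r n) x) \<longlonglongrightarrow> 0" by (rule tendsto_norm_zero_cancel)
    from tendsto_diff[OF tendsto_const[of "u x"] this]
    have "(\<lambda>n. \<phi> (r n) x) \<longlonglongrightarrow> u x" by simp
    moreover have "bdist \<Omega> x > 0" using elim(2) bdist_pos[OF O] by simp
    ultimately show ?case
      using q by (intro tendsto_divide tendsto_powr' tendsto_intros) auto
  qed
  have test': "c * (LINT x|?M. \<bar>\<phi> n x\<bar> powr q / bdist \<Omega> x powr q) \<le> (LINT x|?M. norm (gradient (\<phi> n) x) powr q)" for n
    using test[OF \<phi>] test_function_integrals[OF O \<phi>, of q] q by simp
  let ?f = "\<lambda>x. \<bar>u x\<bar> powr q / bdist \<Omega> x powr q"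
  have mb: "bdist \<Omega> \<in> borel_measurable ?M"
    using borel_measurable_bdist[of \<Omega>] by (intro measurable_restrict_space1 measurable_completion) simp
  have mf: "?f \<in> borel_measurable ?M" using u(1) mb by measurable
  let ?N = "LINT x|?M. norm (g x) powr q"
  \<comment> \<open>The order of limits matters: for fixed \<open>t\<close> the approximation error
    disappears as \<open>n\<close> grows although its factor is large for small \<open>t\<close>;
    only afterwards does \<open>t\<close> tend to 0.\<close>
  have key: "integrable ?M ?f" "integral\<^sup>L ?M ?f \<le> (1 - t) powr (1 - q) * ?N / c"
    if t: "0 < t" "t < 1" for t
  proof -
    let ?b = "\<lambda>n. ((1 - t) powr (1 - q) * ?N + t powr (1 - q) * inverse (real (Suc (r n)))) / c"
    have b: "(LINT x|?M. \<bar>\<phi> (r n) x\<bar> powr q / bdist \<Omega> x powr q) \<le> ?b n" for n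
    proof -
      have "(LINT x|?M. norm (gradient (\<phi> (r n)) x) powr q)
        \<le> (LINT x|?M. (1 - t) powr (1 - q) * norm (g x) powr q
            + t powr (1 - q) * norm (g x - gradient (\<phi> (r n)) x) powr q)"
      proof (rule integral_mono)
        show "norm (gradient (\<phi> (r n)) x) powr q \<le> (1 - t) powr (1 - q) * norm (g x) powr q
            + t powr (1 - q) * norm (g x - gradient (\<phi> (r n)) x) powr q" for x
          using norm_add_powr_le[of q t "g x" "gradient (\<phi> (r n)) x - g x"] q t
          by (simp add: norm_minus_commute)
      qed (use m g iB in auto)
      also have "\<dots> = (1 - t) powr (1 - q) * ?N
          + t powr (1 - q) * (LINT x|?M. norm (g x - gradient (\<phi> (r n)) x) powr q)"
        using g iB by simp
      also have "\<dots> \<le> (1 - t) powr (1 - q) * ?N + t powr (1 - q) * inverse (real (Suc (r n)))"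
        using B[of "r n"] by (intro add_left_mono mult_left_mono) auto
      finally show ?thesis
        using test'[of "r n"] c by (simp add: pos_le_divide_eq mult.commute)
    qed
    have "(\<lambda>n. inverse (real (Suc (r n)))) \<longlonglongrightarrow> 0"
      using LIMSEQ_subseq_LIMSEQ[OF LIMSEQ_inverse_real_of_nat r] by (simp add: o_def)
    then have "?b \<longlonglongrightarrow> ((1 - t) powr (1 - q) * ?N + t powr (1 - q) * 0) / c"
      using c by (intro tendsto_divide tendsto_add tendsto_mult tendsto_const) auto
    then have bl: "?b \<longlonglongrightarrow> (1 - t) powr (1 - q) * ?N / c" by simp
    have i: "integrable ?M (\<lambda>x. \<bar>\<phi> (r n) x\<bar> powr q / bdist \<Omega> x powr q)" for n
      using test_function_integrals(2)[OF O \<phi>] q by simp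
    show "integrable ?M ?f" "integral\<^sup>L ?M ?f \<le> (1 - t) powr (1 - q) * ?N / c"
      by (rule integral_le_of_AE_limit[OF i _ mf _ lim' b bl]; simp)+
  qed
  show "integrable ?M ?f" using key(1)[of "1 / 2"] by simp
  have "((\<lambda>t. (1 - t) powr (1 - q) * ?N / c) \<longlongrightarrow> (1 - 0) powr (1 - q) * ?N / c) (at_right 0)"
    using c by (intro tendsto_intros) auto
  moreover have "\<forall>\<^sub>F t in at_right (0::real). integral\<^sup>L ?M ?f \<le> (1 - t) powr (1 - q) * ?N / c"
    using key(2) by (auto simp: eventually_at_right[of 0 1] intro!: exI[of _ 1])
  ultimately have "integral\<^sup>L ?M ?f \<le> (1 - 0) powr (1 - q) * ?N / c"
    by (rule tendsto_lowerbound) simp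
  then show "c * integral\<^sup>L ?M ?f \<le> ?N"
    using c by (simp add: pos_le_divide_eq mult.commute)
qed

subsection \<open>Hardy constants\<close>

lemma hardy_quotient_nonneg: "0 \<le> hardy_quotient \<Omega> p u g"
  by (simp add: hardy_quotient_def)

lemma hardy_constant_le_quotient:
  assumes "(u, g) \<in> sobolev0 \<Omega> p" "\<not> (AE x in lebesgue_on \<Omega>. u x = 0)"
  shows "hardy_constant \<Omega> p \<le> hardy_quotient \<Omega> p u g"
  unfolding hardy_constant_def
  by (rule cInf_lower) (use assms hardy_quotient_nonneg in \<open>auto intro!: bdd_belowI[of _ 0]\<close>)

lemma hardy_constant_greatest:
  fixes \<Omega> :: "'a::euclidean_space set"
  assumes O: "open \<Omega>" "\<Omega> \<noteq> {}" and p: "p > 0"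
    and "\<And>u g. (u, g) \<in> sobolev0 \<Omega> p \<Longrightarrow> \<not> (AE x in lebesgue_on \<Omega>. u x = 0) \<Longrightarrow>
      c \<le> hardy_quotient \<Omega> p u g"
  shows "c \<le> hardy_constant \<Omega> p"
  unfolding hardy_constant_def
proof (rule cInf_greatest)
  obtain \<phi> where \<phi>: "\<phi> \<in> test_functions \<Omega>" "\<not> (AE x in lebesgue_on \<Omega>. \<phi> x = 0)"
    using exists_nonzero_test_function[OF O] .
  show "{hardy_quotient \<Omega> p u g | u g. (u, g) \<in> sobolev0 \<Omega> p \<and> \<not> (AE x in lebesgue_on \<Omega>. u x = 0)} \<noteq> {}"
    using test_functions_in_sobolev0[OF O(1) \<phi>(1) p] \<phi>(2) by blast
qed (use assms(4) in blast)

lemma hardy_constant_nonneg: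
  fixes \<Omega> :: "'a::euclidean_space set"
  assumes "open \<Omega>" "\<Omega> \<noteq> {}" "p > 0"
  shows "0 \<le> hardy_constant \<Omega> p"
  using hardy_constant_greatest[OF assms] hardy_quotient_nonneg by blast

lemma hardy_inequality_test:
  fixes \<Omega> :: "'a::euclidean_space set"
  assumes O: "open \<Omega>" "\<Omega> \<noteq> UNIV" and p: "p > 0" and \<phi>: "\<phi> \<in> test_functions \<Omega>"
  shows "hardy_constant \<Omega> p * (\<integral>x. \<bar>\<phi> x\<bar> powr p / bdist \<Omega> x powr p \<partial>lborel)
    \<le> (\<integral>x. norm (gradient \<phi> x) powr p \<partial>lborel)"
proof -
  note I = test_function_integrals[OF O \<phi> p]
  let ?D = "LINT x|lebesgue_on \<Omega>. \<bar>\<phi> x\<bar> powr p / bdist \<Omega> x powr p"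
  let ?N = "LINT x|lebesgue_on \<Omega>. norm (gradient \<phi> x) powr p"
  have "hardy_constant \<Omega> p * ?D \<le> ?N"
  \<comment> \<open>Functions vanishing almost everywhere are excluded from the infimum, but the
    inequality in product form holds for them with left-hand side 0.\<close>
  proof (cases "AE x in lebesgue_on \<Omega>. \<phi> x = 0")
    case True
    then have "AE x in lebesgue_on \<Omega>. \<bar>\<phi> x\<bar> powr p / bdist \<Omega> x powr p = 0"
      by eventually_elim simp
    then show ?thesis by (simp add: integral_eq_zero_AE)
  next
    case False
    have "hardy_constant \<Omega> p \<le> ?N / ?D"
      using hardy_constant_le_quotient[OF test_functions_in_sobolev0[OF O(1) \<phi> p] False] I(2)
      by (simp add: hardy_quotient_def)
    moreover have "?D \<ge> 0" by simp
    ultimately show ?thesis by (cases "?D = 0") (auto simp: pos_le_divide_eq)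
  qed
  then show ?thesis using I by simp
qed

text \<open>
  Insert \<open>v = \<bar>\<phi>\<bar>\<^sup>a d\<^sup>1\<^sup>-\<^sup>a\<close> with \<open>a = q / p\<close> into the \<open>L\<^sup>p\<close> Hardy inequality: the exponents are chosen
  so that \<open>(v / d)\<^sup>p = (\<bar>\<phi>\<bar> / d)\<^sup>q\<close>.
\<close>

lemma hardy_inequality_higher_exponent:
  fixes \<Omega> :: "'a::euclidean_space set" and p q :: real
  assumes O: "open \<Omega>" "\<Omega> \<noteq> {}" "\<Omega> \<noteq> UNIV" and p: "p > 1" and q: "q > p"
    and \<phi>: "\<phi> \<in> test_functions \<Omega>"
  defines "\<theta> \<equiv> (hardy_constant \<Omega> p powr (1 / p) + 1) / (q / p) - 1"
  assumes \<theta>: "\<theta> > 0"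
  shows "\<theta> powr q * (\<integral>x. \<bar>\<phi> x\<bar> powr q / bdist \<Omega> x powr q \<partial>lborel)
    \<le> (\<integral>x. norm (gradient \<phi> x) powr q \<partial>lborel)"
proof -
  define a where "a = q / p"
  define h where "h = hardy_constant \<Omega> p powr (1 / p)"
  have a: "a > 1" "a * p = q" using p q by (simp_all add: a_def)
  \<comment> \<open>This is \<open>p * (1 + h) = q * (1 + \<theta>)\<close> divided by
    \<open>p\<close>. It makes \<open>h\<close> the constant of \<open>pointwise_bound\<close>, so
    the factor \<open>h powr p\<close> appears on both sides and cancels.\<close>
  have h\<theta>: "h = a * \<theta> + a - 1" using a(1) by (simp add: \<theta>_def h_def a_def[symmetric] field_simps)
  have h: "h > 0" using h\<theta> a(1) \<theta> by (smt (verit) mult_pos_pos)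
  have H: "hardy_constant \<Omega> p = h powr p"
    using hardy_constant_nonneg[OF O(1,2), of p] p by (simp add: h_def powr_powr)
  let ?d = "bdist \<Omega>"
  obtain K where K: "compact K" "K \<subseteq> \<Omega>" "\<And>x. x \<notin> K \<Longrightarrow> \<phi> x = 0" "\<And>x. x \<notin> K \<Longrightarrow> gradient \<phi> x = 0"
    "continuous_on UNIV \<phi>" "continuous_on UNIV (gradient \<phi>)"
    "\<And>x. (\<phi> has_derivative (\<lambda>h. gradient \<phi> x \<bullet> h)) (at x)"
    using \<phi> by (rule test_functionsE) (rule that)
  have pos: "?d x > 0" if "x \<in> \<Omega>" for x using bdist_pos[OF O(1,3)] that by blast
  define v where "v x = \<bar>\<phi> x\<bar> powr a * ?d x powr (1 - a)" for x
  define G where "G x = a * (\<bar>\<phi> x\<bar> / ?d x) powr (a - 1) * norm (gradient \<phi> x) + (a - 1) * (\<bar>\<phi> x\<bar> / ?d x) powr a" for x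
  have v0: "v x = 0" and G0: "G x = 0" if "x \<notin> K" for x
    using K(3)[OF that] by (simp_all add: v_def G_def)
  have Gpos: "0 \<le> G x" for x
    using a by (simp add: G_def)
  have lip: "lip_at v x (G x)" for x
  proof (cases "x \<in> K")
    case True
    have "lip_at \<phi> x (norm (gradient \<phi> x))"
      by (rule lip_at_C1[where \<rho>=1])
         (use K(6,7) in \<open>auto simp: continuous_on_eq_continuous_at\<close>)
    then have "lip_at (\<lambda>y. \<bar>\<phi> y\<bar> powr a * infdist y (frontier \<Omega>) powr (1 - a)) x (G x)"
      using lip_at_substitution[of \<phi> x "norm (gradient \<phi> x)" a "frontier \<Omega>"] a(1) pos[of x] True K(2)
      by (auto simp: G_def bdist_def)
    then show ?thesis by (simp add: v_def[abs_def] bdist_def)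
  next
    \<comment> \<open>Off \<open>K\<close> the distance may be 0, where its negative powers have no
      Lipschitz bound; but there \<open>v\<close> is 0 on a whole ball.\<close>
    case False
    then obtain r where r: "r > 0" "ball x r \<subseteq> - K"
      using compact_imp_closed[OF K(1)] open_contains_ball[of "- K"] by (auto simp: open_Compl)
    show ?thesis unfolding G0[OF False]
      by (rule lip_at_cong[OF lip_at_const[of 0] r(1)]) (use r(2) v0 in auto)
  qed
  have cX: "continuous_on K (\<lambda>x. (\<bar>\<phi> x\<bar> / ?d x) powr b)" if "b > 0" for b
    using that K(2,5) pos
    by (intro continuous_on_powr' continuous_intros continuous_bdist)
       (auto intro: continuous_on_subset simp: less_imp_neq[symmetric] less_imp_le subset_iff)
  have cG: "continuous_on K G"
    unfolding G_def[abs_def] using a(1)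
    by (intro continuous_intros cX continuous_on_subset[OF K(6)]) auto
  obtain M where M: "\<And>x. norm (G x) \<le> M"
    by (rule bounded_compact_support[OF K(1) cG]) (use G0 that in auto)
  have m\<phi>: "\<phi> \<in> borel_measurable borel" and mg: "gradient \<phi> \<in> borel_measurable borel"
    using K(5,6) by (auto intro: borel_measurable_continuous_onI)
  have mG: "G \<in> borel_measurable borel"
    unfolding G_def[abs_def] using m\<phi> mg by measurable
  have "hardy_constant \<Omega> p * (\<integral>x. \<bar>v x\<bar> powr p / ?d x powr p \<partial>lborel) \<le> (\<integral>x. G x powr p \<partial>lborel)"
  proof (rule weighted_inequality_Lipschitz[OF O(1) p _ _ _ _ K(1,2) _ _ lip mG Gpos, where M=M])
    show "(\<lambda>x. ?d x powr p) \<in> borel_measurable borel" by measurable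
    show "continuous_on \<Omega> (\<lambda>x. ?d x powr p)"
      using pos by (intro continuous_on_powr continuous_bdist continuous_intros) (auto simp: less_imp_neq[symmetric])
    show "\<And>x. x \<in> \<Omega> \<Longrightarrow> ?d x powr p > 0" using pos by (simp add: less_imp_neq[symmetric])
    show "hardy_constant \<Omega> p * (\<integral>x. \<bar>w x\<bar> powr p / ?d x powr p \<partial>lborel)
      \<le> (\<integral>x. norm (gradient w x) powr p \<partial>lborel)" if "w \<in> test_functions \<Omega>" for w
      using hardy_inequality_test[OF O(1,3) _ that, of p] p by simp
    show "G x \<le> M" for x using M[of x] by simp
  qed (use v0 G0 in auto)
  moreover have "\<bar>v x\<bar> powr p / ?d x powr p = \<bar>\<phi> x\<bar> powr q / ?d x powr q" for x
  proof (cases "x \<in> K")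
    case True
    then have d: "?d x > 0" using pos K(2) by auto
    have "\<bar>v x\<bar> powr p = \<bar>\<phi> x\<bar> powr q * ?d x powr (p - q)"
      using a(2) by (simp add: v_def powr_mult powr_powr left_diff_distrib)
    then show ?thesis using d by (simp add: powr_diff field_simps)
  qed (use v0 K(3) in simp)
  ultimately have *: "h powr p * (\<integral>x. \<bar>\<phi> x\<bar> powr q / ?d x powr q \<partial>lborel) \<le> (\<integral>x. G x powr p \<partial>lborel)"
    by (simp add: H)
  let ?X = "\<lambda>x. \<bar>\<phi> x\<bar> powr q / ?d x powr q" and ?Y = "\<lambda>x. norm (gradient \<phi> x) powr q"
  let ?A = "integral\<^sup>L lborel ?X" and ?B = "integral\<^sup>L lborel ?Y"
  have iX: "integrable lborel ?X" and iY: "integrable lborel ?Y"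
    using test_function_integrals(1,4)[OF O(1,3) \<phi>, of q] p q by auto
  \<comment> \<open>The weight from \<open>pointwise_bound\<close>. As \<open>1 - m\<close> and
    \<open>m\<close> add up to 1, the share \<open>1 - m\<close> of \<open>?A\<close> on the right
    is absorbed by the left, and what remains can be divided by \<open>m\<close>.\<close>
  define m where "m = (a * \<theta> / h) * (p / q)"
  have m: "m > 0" using a \<theta> h p q by (simp add: m_def)
  have "(\<integral>x. G x powr p \<partial>lborel) \<le> (\<integral>x. h powr p * ((1 - m) * ?X x + m * (?Y x / \<theta> powr q)) \<partial>lborel)"
  proof (rule integral_mono)
    show "integrable lborel (\<lambda>x. G x powr p)"
      using cG p Gpos G0 by (intro integrable_compact_support[OF K(1)] continuous_on_powr' continuous_intros) auto
    show "integrable lborel (\<lambda>x. h powr p * ((1 - m) * ?X x + m * (?Y x / \<theta> powr q)))"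
      using iX iY
      by (intro integrable_mult_right Bochner_Integration.integrable_add Bochner_Integration.integrable_divide)
    show "G x powr p \<le> h powr p * ((1 - m) * ?X x + m * (?Y x / \<theta> powr q))" for x
    proof -
      have "(\<bar>\<phi> x\<bar> / ?d x) powr q = ?X x"
        by (simp add: powr_divide bdist_def infdist_nonneg)
      then show ?thesis
        using pointwise_bound[OF p q \<theta>, of "\<bar>\<phi> x\<bar> / ?d x" "norm (gradient \<phi> x)"]
        by (simp add: G_def m_def h\<theta> a_def bdist_def infdist_nonneg)
    qed
  qed
  also have "\<dots> = h powr p * ((\<integral>x. (1 - m) * ?X x \<partial>lborel) + (\<integral>x. m * (?Y x / \<theta> powr q) \<partial>lborel))"
    using Bochner_Integration.integral_add[of lborel "\<lambda>x. (1 - m) * ?X x" "\<lambda>x. m * (?Y x / \<theta> powr q)"]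
      integrable_mult_right[OF iX] iY by simp
  also have "\<dots> = h powr p * ((1 - m) * ?A + m * (?B / \<theta> powr q))"
    by (simp only: integral_mult_right_zero integral_divide_zero)
  finally have "h powr p * ?A \<le> h powr p * ((1 - m) * ?A + m * (?B / \<theta> powr q))"
    using * by linarith
  then have "?A \<le> (1 - m) * ?A + m * (?B / \<theta> powr q)" using h by simp
  then have "m * ?A \<le> m * (?B / \<theta> powr q)" by (simp add: left_diff_distrib)
  then have "?A \<le> ?B / \<theta> powr q" using mult_le_cancel_left_pos[OF m] by blast
  then show ?thesis using \<theta> by (simp add: pos_le_divide_eq mult.commute)
qed

theorem theorem2:
  fixes \<Omega> :: "'a::euclidean_space set"
  assumes "open \<Omega>" and "connected \<Omega>" and "\<Omega> \<noteq> {}" and "\<Omega> \<noteq> UNIV"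
  shows "mono_on {1<..} (\<lambda>p::real. p * (1 + hardy_constant \<Omega> p powr (1 / p)))"
proof (rule mono_onI)
  fix p q :: real
  assume "p \<in> {1<..}" "q \<in> {1<..}" "p \<le> q"
  then have p: "p > 1" and q: "q > 1" and pq: "p \<le> q" by auto
  define h where "h = hardy_constant \<Omega> p powr (1 / p)"
  define \<theta> where "\<theta> = (h + 1) / (q / p) - 1"
  have e: "p * (1 + h) = q * (1 + \<theta>)" using p q by (simp add: \<theta>_def field_simps)
  have "p * (1 + h) \<le> q * (1 + hardy_constant \<Omega> q powr (1 / q))"
  \<comment> \<open>By \<open>e\<close> the claim amounts to \<theta> being at most the
    \<open>q\<close>-th root of the Hardy constant for \<open>q\<close>. That root is nonnegative,
    so only positive \<theta> requires the Hardy inequality.\<close>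
  proof (cases "\<theta> > 0 \<and> p < q")
    case True
    then have \<theta>: "\<theta> > 0" and pq: "q > p" by auto
    have test: "\<theta> powr q * (\<integral>x. \<bar>\<phi> x\<bar> powr q / bdist \<Omega> x powr q \<partial>lborel)
      \<le> (\<integral>x. norm (gradient \<phi> x) powr q \<partial>lborel)" if "\<phi> \<in> test_functions \<Omega>" for \<phi>
      using hardy_inequality_higher_exponent[OF assms(1,3,4) p pq that] \<theta> by (simp add: \<theta>_def h_def)
    have "\<theta> powr q \<le> hardy_constant \<Omega> q"
    proof (rule hardy_constant_greatest[OF assms(1,3)])
      fix u :: "'a \<Rightarrow> real" and g :: "'a \<Rightarrow> 'a"
      assume ug: "(u, g) \<in> sobolev0 \<Omega> q" and nz: "\<not> (AE x in lebesgue_on \<Omega>. u x = 0)"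
      let ?f = "\<lambda>x. \<bar>u x\<bar> powr q / bdist \<Omega> x powr q"
      let ?N = "LINT x|lebesgue_on \<Omega>. norm (g x) powr q"
      have i: "integrable (lebesgue_on \<Omega>) ?f"
        and le: "\<theta> powr q * integral\<^sup>L (lebesgue_on \<Omega>) ?f \<le> ?N"
        using hardy_inequality_sobolev0[OF assms(1,4) q _ test ug] \<theta> by auto
      have "integral\<^sup>L (lebesgue_on \<Omega>) ?f \<noteq> 0"
      proof
        assume "integral\<^sup>L (lebesgue_on \<Omega>) ?f = 0"
        then have "AE x in lebesgue_on \<Omega>. ?f x = 0"
          using integral_nonneg_eq_0_iff_AE[OF i] by simp
        then have "AE x in lebesgue_on \<Omega>. u x = 0"
          using AE_space
        proof eventually_elim
          case (elim x)
          then show ?case using bdist_pos[OF assms(1,4), of x] by (auto simp: space_restrict_space)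
        qed
        with nz show False ..
      qed
      moreover have "integral\<^sup>L (lebesgue_on \<Omega>) ?f \<ge> 0" by simp
      ultimately have "integral\<^sup>L (lebesgue_on \<Omega>) ?f > 0" by linarith
      \<comment> \<open>Positivity of the denominator is indispensable here: division by 0 would
        give the quotient the value 0, below \<open>\<theta> powr q\<close>.\<close>
      then show "\<theta> powr q \<le> hardy_quotient \<Omega> q u g"
        using i le by (simp add: hardy_quotient_def pos_le_divide_eq)
    qed (use q in simp)
    then have "(\<theta> powr q) powr (1 / q) \<le> hardy_constant \<Omega> q powr (1 / q)"
      using q by (intro powr_mono2) auto
    then have "\<theta> \<le> hardy_constant \<Omega> q powr (1 / q)"
      using \<theta> q by (simp add: powr_powr)
    then show ?thesis unfolding e using q by simp
  next
    case False
    show ?thesis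
    proof (cases "p = q")
      case False
      then have "\<theta> \<le> 0" using \<open>\<not> (\<theta> > 0 \<and> p < q)\<close> pq by auto
      then have "\<theta> \<le> hardy_constant \<Omega> q powr (1 / q)" using powr_ge_zero order_trans by blast
      then show ?thesis unfolding e using q by simp
    qed (simp add: h_def)
  qed
  then show "p * (1 + hardy_constant \<Omega> p powr (1 / p)) \<le> q * (1 + hardy_constant \<Omega> q powr (1 / q))"
    by (simp add: h_def)
qed

end
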